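(* Fix a prime $p$ and an integer $m\geq 1$. For every $n\geq 1$, let $\mathbf{X}$ be a $\mathbb{Z}^{n\times n}$-valued random matrix whose entries are independent and uniformly distributed on $\{0,1,\ldots,p^{m}-1\}$, and let $b\in\mathbb{Z}^n$ be a deterministic vector with $b\not\equiv 0 \bmod p$. Let $\mathbf{W}\in\mathbb{Z}^{n\times n}$ be the walk matrix with columns $b,\mathbf{X}b,\ldots,\mathbf{X}^{n-1}b$. Fix some $\ell\geq 1$ and integers $0=\lambda_0\leq\lambda_1\leq\cdots\leq\lambda_\ell\leq m$. Let $i_0:=\#\{i\leq \ell:\lambda_i=m\}$ and $\delta_j:=\lambda_{\ell-j+1}-\lambda_{\ell-j}$ for $1\le j\le \ell$. Then, as Abelian groups, $$\lim_{n\to\infty}\mathbb{P}\Big(\operatorname{coker}(\mathbf{W})_{p^m}\cong\bigoplus_{i=1}^{\ell}\mathbb{Z}/p^{\lambda_i}\mathbb{Z}\Big)=\prod_{i=i_0}^{\infty}\big(1-p^{-(i+1)}\big)\prod_{j=1}^{\ell}p^{-j\delta_j}.$$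
   Context: For an integer matrix $\mathbf{M}\in\mathbb{Z}^{n\times n}$, $\operatorname{coker}(\mathbf{M}):=\mathbb{Z}^n/\mathbf{M}(\mathbb{Z}^n)$. For an Abelian group $H$ and a prime power $p^m$, $H_{p^m}:=H/p^mH$. *)

theory Defs
  imports
    "HOL-Probability.Probability"
    "HOL-Algebra.Product_Groups"
    "HOL-Algebra.Elementary_Groups"
    "HOL-Number_Theory.Cong"
    "Jordan_Normal_Form.Matrix"
begin

unbundle no vec_syntax

definition coker :: "int mat \<Rightarrow> int vec set monoid" where
  "coker M = monoid_vec TYPE(int) (dim_row M) Mod ((\<lambda>v. M *\<^sub>v v) ` carrier_vec (dim_col M))"

text \<open>The group is written multiplicatively, so that \<open>k H\<close> is the set of \<open>k\<close>-th powers.\<close>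

definition quot_multiples :: "('a, 'b) monoid_scheme \<Rightarrow> nat \<Rightarrow> 'a set monoid" where
  "quot_multiples H k = H Mod ((\<lambda>x. x [^]\<^bsub>H\<^esub> k) ` carrier H)"

definition walk_matrix :: "int mat \<Rightarrow> int vec \<Rightarrow> int mat" where
  "walk_matrix X b = mat_of_cols (dim_vec b) (map (\<lambda>k. (X ^\<^sub>m k) *\<^sub>v b) [0..<dim_vec b])"

end

theory Submission
  imports Defs "Jordan_Normal_Form.Gauss_Jordan_Elimination"
begin

text \<open>Write \<open>R = \<int>/p\<^sup>m\<close>. The quotient of the cokernel is \<open>R\<^sup>n\<close> modulo the span of
  \<open>b, X b, \<dots>, X\<^bsup>n-1\<^esup> b\<close>. A primitive \<open>b\<close> may be conjugated to a multiple of the first unit vector, since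
  this preserves the uniform distribution of \<open>X\<close>; dividing by it leaves the same problem in dimension
  \<open>n - 1\<close>, with starting vector the lower part of the first column of \<open>X\<close>, which is now uniform and
  independent of the lower right block. For a uniform starting vector \<open>u\<close> in dimension \<open>n\<close> there are two
  cases. With probability \<open>1 - p\<^bsup>-n\<^esup>\<close> it is primitive, and the dimension drops again. Otherwise
  \<open>u = p u'\<close>, the span is \<open>p\<close> times the span for \<open>u'\<close> modulo \<open>p\<^bsup>m-1\<^esup>\<close>, and every one of the \<open>n\<close> parts of
  the type grows by one. In terms of the conjugate partition \<open>c\<close> (numbers of parts exceeding \<open>k\<close>) the
  probability of type \<open>c\<close> is therefore, exactly and for every \<open>n \<ge> c 0\<close>,
  \<open>\<Prod>\<^bsub>k<m\<^esub> p\<^bsup>-c k\<^esup> \<cdot> \<Prod>\<^bsub>c (m-1) < i \<le> n\<^esub> (1 - p\<^bsup>-i\<^esup>)\<close>.\<close>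

subsection \<open>Residues of vectors and matrices\<close>

definition vmod :: "int vec \<Rightarrow> int \<Rightarrow> int vec" (infixl \<open>vmod\<close> 70) where
  "v vmod q = map_vec (\<lambda>a. a mod q) v"

definition mmod :: "int mat \<Rightarrow> int \<Rightarrow> int mat" (infixl \<open>mmod\<close> 70) where
  "A mmod q = map_mat (\<lambda>a. a mod q) A"

lemma dim_vmod [simp]: "dim_vec (v vmod q) = dim_vec v"
  by (simp add: vmod_def)

lemma dim_mmod [simp]: "dim_row (A mmod q) = dim_row A" "dim_col (A mmod q) = dim_col A"
  by (simp_all add: mmod_def)

lemma vmod_carrier [simp]: "v vmod q \<in> carrier_vec n \<longleftrightarrow> v \<in> carrier_vec n"
  by (simp add: vmod_def)

lemma mmod_carrier [simp]: "A mmod q \<in> carrier_mat nr nc \<longleftrightarrow> A \<in> carrier_mat nr nc"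
  by (simp add: mmod_def)

lemma index_vmod [simp]: "i < dim_vec v \<Longrightarrow> (v vmod q) $ i = v $ i mod q"
  by (simp add: vmod_def)

lemma index_mmod [simp]:
  "i < dim_row A \<Longrightarrow> j < dim_col A \<Longrightarrow> (A mmod q) $$ (i, j) = A $$ (i, j) mod q"
  by (simp add: mmod_def)

lemma mmod_mmod [simp]: "A mmod q mmod q = A mmod q"
  by (intro eq_matI) simp_all

lemma vmod_eq_iff:
  "v vmod q = w vmod q \<longleftrightarrow> dim_vec v = dim_vec w \<and> (\<forall>i<dim_vec w. [v $ i = w $ i] (mod q))"
  by (auto simp: vec_eq_iff cong_def)

lemma vmod_add: "dim_vec x = dim_vec y \<Longrightarrow> (x vmod q + y vmod q) vmod q = (x + y) vmod q"
  by (intro eq_vecI) (simp_all add: mod_add_eq)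

lemma vmod_smult: "(t \<cdot>\<^sub>v (x vmod q)) vmod q = (t \<cdot>\<^sub>v x) vmod q"
  by (intro eq_vecI) (simp_all add: mod_mult_right_eq)

lemma vmod_mult_modulus: "(r \<cdot>\<^sub>v x) vmod (r * q) = r \<cdot>\<^sub>v (x vmod q)"
  by (intro eq_vecI) simp_all

lemma vmod_vCons: "vCons t x vmod q = vCons (t mod q) (x vmod q)"
  by (intro eq_vecI) (simp_all add: vec_index_vCons)

lemma scalar_prod_vmod:
  assumes "dim_vec x = dim_vec y"
  shows "scalar_prod (x vmod q) (y vmod q) mod q = scalar_prod x y mod q"
proof -
  have "[(\<Sum>i<dim_vec y. (x vmod q) $ i * (y vmod q) $ i) = (\<Sum>i<dim_vec y. x $ i * y $ i)] (mod q)"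
    using assms by (intro cong_sum cong_mult) (simp_all add: cong_def)
  thus ?thesis by (simp add: scalar_prod_def cong_def atLeast0LessThan)
qed

lemma row_mmod: "i < dim_row A \<Longrightarrow> row (A mmod q) i = row A i vmod q"
  by (intro eq_vecI) simp_all

lemma col_mmod: "j < dim_col A \<Longrightarrow> col (A mmod q) j = col A j vmod q"
  by (intro eq_vecI) simp_all

lemma mult_mat_vec_vmod:
  "dim_col A = dim_vec x \<Longrightarrow> ((A mmod q) *\<^sub>v (x vmod q)) vmod q = (A *\<^sub>v x) vmod q"
  by (intro eq_vecI) (simp_all add: row_mmod scalar_prod_vmod)

lemma mult_mat_mmod:
  "dim_col A = dim_row B \<Longrightarrow> ((A mmod q) * (B mmod q)) mmod q = (A * B) mmod q"
  by (intro eq_matI) (simp_all add: row_mmod col_mmod scalar_prod_vmod)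

lemma mult_mat_vec_vmod_cong:
  assumes "dim_col A = dim_vec x" and "x vmod q = y vmod q"
  shows "(A *\<^sub>v x) vmod q = (A *\<^sub>v y) vmod q"
  using assms by (metis dim_vmod mult_mat_vec_vmod)

lemma conj_mat_mmod:
  assumes "P \<in> carrier_mat n n" "A \<in> carrier_mat n n" "Q \<in> carrier_mat n n"
  shows "(P * (A mmod q) * Q) mmod q = (P * A * Q) mmod q"
proof -
  have "(P * B * Q) mmod q = ((((P mmod q) * (B mmod q)) mmod q) * (Q mmod q)) mmod q"
    if "B \<in> carrier_mat n n" for B
    using assms that by (simp add: mult_mat_mmod del: assoc_mult_mat)
  from this[of A] this[of "A mmod q"] show ?thesis using assms by simp
qed

lemma dvd_vec_imp_smult:
  fixes v :: "int vec"
  assumes v: "v \<in> carrier_vec n" and dvd: "\<And>i. i < n \<Longrightarrow> r dvd v $ i"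
  obtains w where "w \<in> carrier_vec n" "v = r \<cdot>\<^sub>v w"
proof
  show "v = r \<cdot>\<^sub>v vec n (\<lambda>i. v $ i div r)" using v dvd by (intro eq_vecI) simp_all
qed simp

subsection \<open>Inverse matrices\<close>

definition inverse_mats :: "nat \<Rightarrow> 'a :: semiring_1 mat \<Rightarrow> 'a mat \<Rightarrow> bool" where
  "inverse_mats n P Q \<longleftrightarrow>
    P \<in> carrier_mat n n \<and> Q \<in> carrier_mat n n \<and> P * Q = 1\<^sub>m n \<and> Q * P = 1\<^sub>m n"

lemma inverse_matsD:
  assumes "inverse_mats n P Q"
  shows "P \<in> carrier_mat n n" "Q \<in> carrier_mat n n" "P * Q = 1\<^sub>m n" "Q * P = 1\<^sub>m n"
  using assms by (simp_all add: inverse_mats_def)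

lemma inverse_mats_sym: "inverse_mats n P Q \<Longrightarrow> inverse_mats n Q P"
  by (simp add: inverse_mats_def)

lemma inverse_mats_mult:
  assumes "inverse_mats n P Q" and "inverse_mats n U V"
  shows "inverse_mats n (P * U) (V * Q)"
proof -
  note PQ = inverse_matsD[OF assms(1)] and UV = inverse_matsD[OF assms(2)]
  have "(P * U) * (V * Q) = P * ((U * V) * Q)" "(V * Q) * (P * U) = V * ((Q * P) * U)"
    using PQ(1,2) UV(1,2) by (simp_all add: assoc_mult_mat[of _ n n _ n _ n])
  thus ?thesis using PQ UV by (simp add: inverse_mats_def)
qed

lemma inverse_mats_mult_vec:
  assumes "inverse_mats n P Q" and "x \<in> carrier_vec n"
  shows "P *\<^sub>v (Q *\<^sub>v x) = x"
  using inverse_matsD[OF assms(1)] assms(2) by (simp flip: assoc_mult_mat_vec[of P n n Q n])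

lemma inverse_mats_conj:
  assumes "inverse_mats n P Q" and "A \<in> carrier_mat n n"
  shows "P * (Q * A * P) * Q = A"
proof -
  note PQ = inverse_matsD[OF assms(1)]
  have "P * (Q * A * P) * Q = (P * Q) * A * (P * Q)"
    using PQ(1,2) assms(2) by (simp add: assoc_mult_mat[of _ n n _ n _ n])
  thus ?thesis using assms(2) by (simp add: PQ(3))
qed

subsection \<open>Krylov subgroups\<close>

primrec krylov :: "int mat \<Rightarrow> int vec \<Rightarrow> nat \<Rightarrow> int vec set" where
  "krylov A v 0 = {0\<^sub>v (dim_vec v)}"
| "krylov A v (Suc k) = (\<Union>t. (\<lambda>y. t \<cdot>\<^sub>v v + A *\<^sub>v y) ` krylov A v k)"

definition krylov_mod :: "int \<Rightarrow> int mat \<Rightarrow> int vec \<Rightarrow> int vec set" where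
  "krylov_mod q A v = {x. \<exists>y\<in>krylov A v (dim_vec v). x vmod q = y vmod q}"

lemma mult_mat_vec_smult:
  fixes A :: "int mat"
  assumes "A \<in> carrier_mat nr nc" "v \<in> carrier_vec nc"
  shows "A *\<^sub>v (r \<cdot>\<^sub>v v) = r \<cdot>\<^sub>v (A *\<^sub>v v)"
  using assms by (intro eq_vecI) simp_all

lemma krylov_subset_carrier:
  assumes "A \<in> carrier_mat n n" "v \<in> carrier_vec n"
  shows "krylov A v k \<subseteq> carrier_vec n"
  using assms by (induction k) auto

lemma krylov_conj:
  assumes PQ: "inverse_mats n P Q" and A: "A \<in> carrier_mat n n" and v: "v \<in> carrier_vec n"
  shows "krylov (P * A * Q) (P *\<^sub>v v) k = (\<lambda>x. P *\<^sub>v x) ` krylov A v k"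
proof (induction k)
  case 0
  show ?case using v inverse_matsD[OF PQ] by (auto simp: mult_mat_vec_def)
next
  case (Suc k)
  note P = inverse_matsD(1)[OF PQ] and Q = inverse_matsD(2)[OF PQ]
  have "t \<cdot>\<^sub>v (P *\<^sub>v v) + (P * A * Q) *\<^sub>v (P *\<^sub>v y) = P *\<^sub>v (t \<cdot>\<^sub>v v + A *\<^sub>v y)"
    if "y \<in> krylov A v k" for t y
  proof -
    have y: "y \<in> carrier_vec n" using that krylov_subset_carrier[OF A v] by blast
    have "(P * A * Q) *\<^sub>v (P *\<^sub>v y) = (P * A) *\<^sub>v (Q *\<^sub>v (P *\<^sub>v y))"
      using P A Q y by (intro assoc_mult_mat_vec[of _ n n _ n]) simp_all
    also have "\<dots> = P *\<^sub>v (A *\<^sub>v y)"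
      unfolding inverse_mats_mult_vec[OF inverse_mats_sym[OF PQ] y] using P A y by (rule assoc_mult_mat_vec)
    finally show ?thesis using P A y v
      by (simp add: mult_add_distrib_mat_vec[of _ n n] mult_mat_vec_smult[of _ n n])
  qed
  thus ?case by (simp add: Suc image_image image_UN cong: image_cong_simp)
qed

lemma krylov_smult:
  assumes A: "A \<in> carrier_mat n n" and v: "v \<in> carrier_vec n"
  shows "krylov A (r \<cdot>\<^sub>v v) k = (\<lambda>x. r \<cdot>\<^sub>v x) ` krylov A v k"
proof (induction k)
  case 0
  show ?case by auto
next
  case (Suc k)
  have "t \<cdot>\<^sub>v (r \<cdot>\<^sub>v v) + A *\<^sub>v (r \<cdot>\<^sub>v y) = r \<cdot>\<^sub>v (t \<cdot>\<^sub>v v + A *\<^sub>v y)"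
    if "y \<in> krylov A v k" for t y
  proof -
    have "y \<in> carrier_vec n" using that krylov_subset_carrier[OF A v] by blast
    thus ?thesis using A v
      by (simp add: mult_mat_vec_smult[of _ n n] smult_add_distrib_vec[of _ n]
          smult_smult_assoc mult.commute)
  qed
  thus ?case by (simp add: Suc image_image image_UN cong: image_cong_simp)
qed

lemma krylov_vmod_subset:
  assumes AB: "A mmod q = B mmod q" and vw: "v vmod q = w vmod q"
    and A: "A \<in> carrier_mat n n" and v: "v \<in> carrier_vec n"
    and x: "x \<in> krylov A v k"
  shows "\<exists>y\<in>krylov B w k. x vmod q = y vmod q"
  using x
proof (induction k arbitrary: x)
  case 0
  thus ?case using arg_cong[OF vw, of dim_vec] by simp
next
  case (Suc k)
  have B: "B \<in> carrier_mat n n" and w: "w \<in> carrier_vec n"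
    using A AB v vw by (metis mmod_carrier, metis vmod_carrier)
  have linear: "(t \<cdot>\<^sub>v u + C *\<^sub>v y) vmod q
      = ((t \<cdot>\<^sub>v (u vmod q)) vmod q + ((C mmod q) *\<^sub>v (y vmod q)) vmod q) vmod q"
    if "C \<in> carrier_mat n n" "u \<in> carrier_vec n" "y \<in> carrier_vec n" for t u C y
    using that by (simp add: vmod_smult mult_mat_vec_vmod vmod_add)
  obtain t z where x: "x = t \<cdot>\<^sub>v v + A *\<^sub>v z" and z: "z \<in> krylov A v k" using Suc.prems by auto
  obtain y where y: "y \<in> krylov B w k" "z vmod q = y vmod q" using Suc.IH[OF z] by blast
  have "z \<in> carrier_vec n" "y \<in> carrier_vec n"
    using z y(1) krylov_subset_carrier A B v w by blast+
  hence "x vmod q = (t \<cdot>\<^sub>v w + B *\<^sub>v y) vmod q"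
    unfolding x using A B v w by (simp add: linear AB vw y(2))
  thus ?case using y(1) by auto
qed

lemma krylov_mod_cong:
  assumes "A mmod q = B mmod q" and "v vmod q = w vmod q"
    and "A \<in> carrier_mat n n" and "v \<in> carrier_vec n"
  shows "krylov_mod q A v = krylov_mod q B w"
proof -
  have "B \<in> carrier_mat n n" and "w \<in> carrier_vec n" and dim: "dim_vec v = dim_vec w"
    using assms by (metis mmod_carrier, metis vmod_carrier, metis dim_vmod)
  hence "\<exists>y\<in>krylov A v k. x vmod q = y vmod q" if "x \<in> krylov B w k" for x k
    using that assms by (intro krylov_vmod_subset[of B q A w v]) auto
  moreover have "\<exists>y\<in>krylov B w k. x vmod q = y vmod q" if "x \<in> krylov A v k" for x k
    using that assms by (intro krylov_vmod_subset[of A q B v w]) auto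
  ultimately show ?thesis unfolding krylov_mod_def dim by (intro Collect_cong) metis
qed

lemma krylov_mod_subset_carrier:
  assumes "A \<in> carrier_mat n n" and "v \<in> carrier_vec n"
  shows "krylov_mod q A v \<subseteq> carrier_vec n"
proof
  fix x assume "x \<in> krylov_mod q A v"
  then obtain y where "y \<in> krylov A v (dim_vec v)" "x vmod q = y vmod q"
    by (auto simp: krylov_mod_def)
  thus "x \<in> carrier_vec n"
    using krylov_subset_carrier[OF assms] by (metis vmod_carrier subsetD)
qed

lemma krylov_mod_smult:
  assumes A: "A \<in> carrier_mat n n" and v: "v \<in> carrier_vec n" and r: "r \<noteq> 0"
  shows "krylov_mod (r * q) A (r \<cdot>\<^sub>v v) = (\<lambda>x. r \<cdot>\<^sub>v x) ` krylov_mod q A v"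
proof (intro equalityI subsetI)
  fix x assume "x \<in> krylov_mod (r * q) A (r \<cdot>\<^sub>v v)"
  then obtain y where y: "y \<in> krylov A v (dim_vec v)" and xy: "x vmod (r * q) = r \<cdot>\<^sub>v (y vmod q)"
    by (auto simp: krylov_mod_def krylov_smult[OF A v] vmod_mult_modulus)
  have "r dvd x $ i" if i: "i < dim_vec x" for i
  proof -
    have "x $ i mod (r * q) = r * (y $ i mod q)"
      using i arg_cong[OF xy, of "\<lambda>u. u $ i"] arg_cong[OF xy, of dim_vec] by simp
    thus ?thesis by (metis dvd_mod_iff dvd_triv_left)
  qed
  then obtain z where x: "x = r \<cdot>\<^sub>v z" by (metis dvd_vec_imp_smult carrier_vec_dim_vec)
  have "r \<cdot>\<^sub>v (z vmod q) = r \<cdot>\<^sub>v (y vmod q)" using xy by (simp add: x vmod_mult_modulus)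
  hence "z vmod q = y vmod q" using r by (auto simp: vec_eq_iff)
  thus "x \<in> (\<lambda>x. r \<cdot>\<^sub>v x) ` krylov_mod q A v" using y x by (auto simp: krylov_mod_def)
next
  fix x assume "x \<in> (\<lambda>x. r \<cdot>\<^sub>v x) ` krylov_mod q A v"
  thus "x \<in> krylov_mod (r * q) A (r \<cdot>\<^sub>v v)"
    by (auto simp: krylov_mod_def krylov_smult[OF A v] vmod_mult_modulus)
qed

lemma mult_mat_vec_mem_krylov_mod_conj:
  assumes PQ: "inverse_mats n P Q" and A: "A \<in> carrier_mat n n" and v: "v \<in> carrier_vec n"
    and x: "x \<in> krylov_mod q A v"
  shows "P *\<^sub>v x \<in> krylov_mod q (P * A * Q) (P *\<^sub>v v)"
proof -
  note P = inverse_matsD(1)[OF PQ]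
  obtain y where y: "y \<in> krylov A v n" "x vmod q = y vmod q" using x v by (auto simp: krylov_mod_def)
  have "x \<in> carrier_vec n" using x krylov_mod_subset_carrier[OF A v] by blast
  hence "(P *\<^sub>v x) vmod q = (P *\<^sub>v y) vmod q" using P y(2) by (intro mult_mat_vec_vmod_cong) simp_all
  thus ?thesis using y(1) P by (auto simp: krylov_mod_def krylov_conj[OF PQ A v])
qed

lemma krylov_mod_conj:
  assumes PQ: "inverse_mats n P Q" and A: "A \<in> carrier_mat n n" and v: "v \<in> carrier_vec n"
  shows "krylov_mod q (P * A * Q) (P *\<^sub>v v) = (\<lambda>x. P *\<^sub>v x) ` krylov_mod q A v"
proof (intro equalityI subsetI)
  note QP = inverse_mats_sym[OF PQ]
  have PAQ: "P * A * Q \<in> carrier_mat n n" and Pv: "P *\<^sub>v v \<in> carrier_vec n"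
    using inverse_matsD[OF PQ] A v by simp_all
  fix x assume x: "x \<in> krylov_mod q (P * A * Q) (P *\<^sub>v v)"
  have "Q *\<^sub>v x \<in> krylov_mod q (Q * (P * A * Q) * P) (Q *\<^sub>v (P *\<^sub>v v))"
    by (rule mult_mat_vec_mem_krylov_mod_conj[OF QP PAQ Pv x])
  hence "Q *\<^sub>v x \<in> krylov_mod q A v"
    unfolding inverse_mats_conj[OF QP A] inverse_mats_mult_vec[OF QP v] .
  moreover have "x \<in> carrier_vec n" using x krylov_mod_subset_carrier[OF PAQ Pv] by blast
  hence "x = P *\<^sub>v (Q *\<^sub>v x)" by (simp add: inverse_mats_mult_vec[OF PQ])
  ultimately show "x \<in> (\<lambda>x. P *\<^sub>v x) ` krylov_mod q A v" by blast
qed (use mult_mat_vec_mem_krylov_mod_conj[OF assms] in blast)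

lemma krylov_closed_smult:
  assumes A: "A \<in> carrier_mat n n" and v: "v \<in> carrier_vec n" and x: "x \<in> krylov A v k"
  shows "s \<cdot>\<^sub>v x \<in> krylov A v k"
  using x
proof (induction k arbitrary: x)
  case 0
  thus ?case by auto
next
  case (Suc k)
  then obtain t y where x: "x = t \<cdot>\<^sub>v v + A *\<^sub>v y" and y: "y \<in> krylov A v k" by auto
  have "y \<in> carrier_vec n" using y krylov_subset_carrier[OF A v] by blast
  hence "s \<cdot>\<^sub>v x = (s * t) \<cdot>\<^sub>v v + A *\<^sub>v (s \<cdot>\<^sub>v y)"
    unfolding x using A v
    by (simp add: mult_mat_vec_smult[of _ n n] smult_add_distrib_vec[of _ n] smult_smult_assoc)
  thus ?case using Suc.IH[OF y] by auto
qed

lemma krylov_mod_unit_smult: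
  assumes A: "A \<in> carrier_mat n n" and v: "v \<in> carrier_vec n" and s: "coprime s q"
  shows "krylov_mod q A (s \<cdot>\<^sub>v v) = krylov_mod q A v"
proof (intro equalityI subsetI)
  fix x assume "x \<in> krylov_mod q A (s \<cdot>\<^sub>v v)"
  thus "x \<in> krylov_mod q A v"
    using krylov_closed_smult[OF A v] by (auto simp: krylov_mod_def krylov_smult[OF A v])
next
  fix x assume "x \<in> krylov_mod q A v"
  then obtain y where y: "y \<in> krylov A v n" and xy: "x vmod q = y vmod q"
    using v by (auto simp: krylov_mod_def)
  obtain r where "[s * r = 1] (mod q)" using cong_solve_coprime_int[OF s] by blast
  hence "[s * r * y $ i = 1 * y $ i] (mod q)" for i by (intro cong_mult cong_refl)
  hence "x vmod q = (s \<cdot>\<^sub>v (r \<cdot>\<^sub>v y)) vmod q"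
    unfolding xy by (simp add: vmod_eq_iff mult.assoc cong_sym_eq)
  thus "x \<in> krylov_mod q A (s \<cdot>\<^sub>v v)"
    using krylov_closed_smult[OF A v y] v by (auto simp: krylov_mod_def krylov_smult[OF A v])
qed

lemma krylov_mod_1:
  assumes "A \<in> carrier_mat n n" and "v \<in> carrier_vec n"
  shows "krylov_mod 1 A v = carrier_vec n"
proof -
  have "krylov A v k \<noteq> {}" for k by (induction k) auto
  then obtain y where y: "y \<in> krylov A v n" by blast
  hence "y \<in> carrier_vec n" using krylov_subset_carrier[OF assms] by blast
  hence "x vmod 1 = y vmod 1" if "x \<in> carrier_vec n" for x
    using that by (simp add: vmod_eq_iff cong_def)
  thus ?thesis using y krylov_mod_subset_carrier[OF assms] assms(2) by (auto simp: krylov_mod_def)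
qed

text \<open>Dividing \<open>\<int>\<^bsup>n+1\<^esup>\<close> by the first unit vector leaves the lower right block of the matrix
  acting on \<open>\<int>\<^sup>n\<close>, with the lower part of the first column as new starting vector.\<close>

definition lower_block :: "'a mat \<Rightarrow> 'a mat" where
  "lower_block A = mat (dim_row A - 1) (dim_col A - 1) (\<lambda>(i, j). A $$ (Suc i, Suc j))"

definition lower_col :: "'a mat \<Rightarrow> 'a vec" where
  "lower_col A = vec (dim_row A - 1) (\<lambda>i. A $$ (Suc i, 0))"

lemma dim_lower_block [simp]:
  "dim_row (lower_block A) = dim_row A - 1" "dim_col (lower_block A) = dim_col A - 1"
  by (simp_all add: lower_block_def)

lemma dim_lower_col [simp]: "dim_vec (lower_col A) = dim_row A - 1"
  by (simp add: lower_col_def)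

lemma lower_block_carrier [simp]:
  "A \<in> carrier_mat (Suc nr) (Suc nc) \<Longrightarrow> lower_block A \<in> carrier_mat nr nc"
  by (simp add: lower_block_def)

lemma lower_col_carrier [simp]: "A \<in> carrier_mat (Suc nr) nc \<Longrightarrow> lower_col A \<in> carrier_vec nr"
  by (simp add: lower_col_def)

lemma unit_vec_0_smult: "(t :: int) \<cdot>\<^sub>v unit_vec (Suc n) 0 = vCons t (0\<^sub>v n)"
  by (intro eq_vecI) (auto simp: vec_index_vCons)

lemma vCons_zero_add: "dim_vec x = n \<Longrightarrow> vCons (a :: int) (0\<^sub>v n) + vCons b x = vCons (a + b) x"
  by (intro eq_vecI) (simp_all add: vec_index_vCons)

lemma mult_mat_vec_vCons:
  fixes A :: "'a :: comm_semiring_0 mat"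
  assumes A: "A \<in> carrier_mat (Suc nr) (Suc nc)"
  shows "A *\<^sub>v vCons t x
    = vCons (scalar_prod (row A 0) (vCons t x)) (t \<cdot>\<^sub>v lower_col A + lower_block A *\<^sub>v x)"
proof (intro eq_vecI)
  fix i
  assume i: "i < dim_vec (vCons (scalar_prod (row A 0) (vCons t x))
    (t \<cdot>\<^sub>v lower_col A + lower_block A *\<^sub>v x))"
  show "(A *\<^sub>v vCons t x) $ i
    = vCons (scalar_prod (row A 0) (vCons t x)) (t \<cdot>\<^sub>v lower_col A + lower_block A *\<^sub>v x) $ i"
  proof (cases i)
    case 0
    thus ?thesis using A by simp
  next
    case (Suc r)
    hence r: "r < nr" using i A by simp
    hence "row A (Suc r) = vCons (lower_col A $ r) (row (lower_block A) r)"
      using A by (intro eq_vecI) (auto simp: vec_index_vCons lower_col_def lower_block_def)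
    thus ?thesis using r A Suc by (simp add: mult.commute)
  qed
qed (use A in simp)

lemma krylov_unit_vec:
  assumes A: "A \<in> carrier_mat (Suc n) (Suc n)"
  shows "krylov A (unit_vec (Suc n) 0) (Suc k)
    = (\<Union>t. vCons t ` krylov (lower_block A) (lower_col A) k)"
proof (induction k)
  case 0
  have "A *\<^sub>v 0\<^sub>v (Suc n) = 0\<^sub>v (Suc n)" using A by (intro eq_vecI) simp_all
  thus ?case using A by (auto simp: unit_vec_0_smult zero_vec_Suc vCons_zero_add)
next
  case (Suc k)
  let ?K = "krylov (lower_block A) (lower_col A) k"
  have "?K \<subseteq> carrier_vec n" using A by (intro krylov_subset_carrier) simp_all
  hence step: "t \<cdot>\<^sub>v unit_vec (Suc n) 0 + A *\<^sub>v vCons s y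
      = vCons (t + scalar_prod (row A 0) (vCons s y)) (s \<cdot>\<^sub>v lower_col A + lower_block A *\<^sub>v y)"
    if "y \<in> ?K" for t s y
    using that A by (subst mult_mat_vec_vCons[OF A]) (auto simp: unit_vec_0_smult vCons_zero_add)
  show ?case
  proof (intro equalityI subsetI)
    fix x assume "x \<in> krylov A (unit_vec (Suc n) 0) (Suc (Suc k))"
    then obtain t s y where "x = t \<cdot>\<^sub>v unit_vec (Suc n) 0 + A *\<^sub>v vCons s y" and "y \<in> ?K"
      by (subst (asm) krylov.simps(2), subst (asm) Suc) auto
    thus "x \<in> (\<Union>t. vCons t ` krylov (lower_block A) (lower_col A) (Suc k))"
      using step by auto
  next
    fix x assume "x \<in> (\<Union>t. vCons t ` krylov (lower_block A) (lower_col A) (Suc k))"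
    then obtain a s y where x: "x = vCons a (s \<cdot>\<^sub>v lower_col A + lower_block A *\<^sub>v y)" and y: "y \<in> ?K"
      by auto
    have "x = (a - scalar_prod (row A 0) (vCons s y)) \<cdot>\<^sub>v unit_vec (Suc n) 0 + A *\<^sub>v vCons s y"
      unfolding x step[OF y] by simp
    thus "x \<in> krylov A (unit_vec (Suc n) 0) (Suc (Suc k))"
      using y by (subst krylov.simps(2), subst Suc) blast
  qed
qed

lemma krylov_mod_unit_vec:
  assumes A: "A \<in> carrier_mat (Suc n) (Suc n)"
  shows "krylov_mod q A (unit_vec (Suc n) 0)
    = (\<Union>t. vCons t ` krylov_mod q (lower_block A) (lower_col A))"
proof (intro equalityI subsetI)
  have dim: "dim_vec (lower_col A) = n" using A by simp
  {
    fix x assume "x \<in> krylov_mod q A (unit_vec (Suc n) 0)"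
    then obtain s y where y: "y \<in> krylov (lower_block A) (lower_col A) n"
      and xy: "x vmod q = vCons s y vmod q"
      unfolding krylov_mod_def by (auto simp: krylov_unit_vec[OF A] simp del: krylov.simps)
    obtain t z where "x = vCons t z"
      using xy by (cases x) (auto simp: vmod_eq_iff)
    thus "x \<in> (\<Union>t. vCons t ` krylov_mod q (lower_block A) (lower_col A))"
      using xy y by (auto simp: vmod_vCons krylov_mod_def dim simp del: dim_lower_col)
  next
    fix x assume "x \<in> (\<Union>t. vCons t ` krylov_mod q (lower_block A) (lower_col A))"
    then obtain t z y where "x = vCons t z" "y \<in> krylov (lower_block A) (lower_col A) n"
      "z vmod q = y vmod q" by (auto simp: krylov_mod_def dim simp del: dim_lower_col)
    thus "x \<in> krylov_mod q A (unit_vec (Suc n) 0)"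
      unfolding krylov_mod_def
      by (auto simp: krylov_unit_vec[OF A] vmod_vCons simp del: krylov.simps)
  }
qed

subsection \<open>Smith normal form of Krylov subgroups\<close>

lemma swaprows_mat_mult_unit_vec:
  assumes "k < n" and "l < n"
  shows "swaprows_mat n k l *\<^sub>v (unit_vec n k :: 'a :: semiring_1 vec) = unit_vec n l"
  using assms by (intro eq_vecI) (auto simp: swaprows_mat_def)

lemma exists_inverse_mats_to_unit_vec:
  fixes u :: "'a :: comm_ring_1 vec"
  assumes u: "u \<in> carrier_vec n" and s: "s < n" "u $ s = 1" and t: "t < n"
  obtains P Q where "inverse_mats n P Q" "P *\<^sub>v u = unit_vec n t"
proof -
  define E where "E a = mat n n (\<lambda>(i, j).
    (if i = j then 1 else 0) + (if j = s then if i = s then 0 else a * u $ i else 0))" for a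
  have E: "E a \<in> carrier_mat n n" for a by (simp add: E_def)
  have E_row: "(\<Sum>k<n. E a $$ (i, k) * f k) = f i + (if i = s then 0 else a * u $ i * f s)"
    if "i < n" for i a and f :: "nat \<Rightarrow> 'a"
    using that s
    by (simp add: E_def distrib_right sum.distrib if_distrib[of "\<lambda>a. a * f k" for k] cong: if_cong)
  have "E a * E b = E (a + b)" for a b
  proof (rule eq_matI)
    fix i j assume "i < dim_row (E (a + b))" "j < dim_col (E (a + b))"
    hence ij: "i < n" "j < n" by (simp_all add: E_def)
    hence "(E a * E b) $$ (i, j) = (\<Sum>k<n. E a $$ (i, k) * E b $$ (k, j))"
      using carrier_matD[OF E] by (simp add: scalar_prod_def atLeast0LessThan)
    thus "(E a * E b) $$ (i, j) = E (a + b) $$ (i, j)"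
      unfolding E_row[OF ij(1)] using ij s(1) by (simp add: E_def distrib_right)
  qed (simp_all add: E_def)
  moreover have "E 0 = 1\<^sub>m n" by (intro eq_matI) (simp_all add: E_def)
  ultimately have inv_E: "inverse_mats n (E (- 1)) (E 1)" using E by (simp add: inverse_mats_def)
  have inv_swap: "inverse_mats n (swaprows_mat n s t) (swaprows_mat n s t :: 'a mat)"
    using s(1) t by (simp add: inverse_mats_def swaprows_mat_inv)
  have "E (- 1) *\<^sub>v u = unit_vec n s"
  proof (rule eq_vecI)
    fix i assume "i < dim_vec (unit_vec n s :: 'a vec)"
    hence i: "i < n" by simp
    hence "(E (- 1) *\<^sub>v u) $ i = (\<Sum>k<n. E (- 1) $$ (i, k) * u $ k)"
      using carrier_matD[OF E] u by (simp add: scalar_prod_def atLeast0LessThan)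
    thus "(E (- 1) *\<^sub>v u) $ i = unit_vec n s $ i" using i s by (simp add: E_row)
  qed (simp add: E_def)
  hence "(swaprows_mat n s t * E (- 1)) *\<^sub>v u = unit_vec n t"
    using E u s(1) t by (simp add: assoc_mult_mat_vec[of _ n n _ n] swaprows_mat_mult_unit_vec)
  thus thesis using that inverse_mats_mult[OF inv_swap inv_E] by blast
qed

lemma exists_inverse_mats_to_unit_vec_mod:
  assumes v: "v \<in> carrier_vec n" and s: "s < n" "coprime (v $ s) q" and t: "t < n"
  obtains P Q where "inverse_mats n P Q" "(P *\<^sub>v v) vmod q = ((v $ s) \<cdot>\<^sub>v unit_vec n t) vmod q"
proof -
  obtain w where w: "[v $ s * w = 1] (mod q)" using cong_solve_coprime_int[OF s(2)] by blast
  define u where "u = vec n (\<lambda>i. if i = s then 1 else w * v $ i)"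
  have u: "u \<in> carrier_vec n" "u $ s = 1" using s by (simp_all add: u_def)
  then obtain P Q where PQ: "inverse_mats n P Q" and Pu: "P *\<^sub>v u = unit_vec n t"
    using s(1) t by (metis exists_inverse_mats_to_unit_vec)
  note P = inverse_matsD(1)[OF PQ]
  have "[v $ i = v $ s * (w * v $ i)] (mod q)" for i
    using cong_sym[OF cong_mult[OF w cong_refl[of "v $ i"]]] by (simp add: mult.assoc)
  hence "v vmod q = ((v $ s) \<cdot>\<^sub>v u) vmod q"
    using v by (auto simp: vmod_eq_iff u_def)
  hence "(P *\<^sub>v v) vmod q = (P *\<^sub>v ((v $ s) \<cdot>\<^sub>v u)) vmod q"
    using P v by (intro mult_mat_vec_vmod_cong) simp_all
  also have "P *\<^sub>v ((v $ s) \<cdot>\<^sub>v u) = (v $ s) \<cdot>\<^sub>v unit_vec n t"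
    using P u(1) by (simp add: mult_mat_vec_smult Pu)
  finally show thesis using that PQ by blast
qed

text \<open>Dividing \<open>\<int>\<^sup>n\<close> by \<open>N\<close> gives the sum of the cyclic groups of orders \<open>d 0, \<dots>, d (n - 1)\<close>.\<close>

definition smith_form :: "nat \<Rightarrow> int vec set \<Rightarrow> (nat \<Rightarrow> int) \<Rightarrow> bool" where
  "smith_form n N d \<longleftrightarrow> (\<exists>U V. inverse_mats n U V \<and>
     N = {x \<in> carrier_vec n. \<forall>i<n. d i dvd (U *\<^sub>v x) $ i})"

lemma smith_formI:
  "inverse_mats n U V \<Longrightarrow> N = {x \<in> carrier_vec n. \<forall>i<n. d i dvd (U *\<^sub>v x) $ i} \<Longrightarrow> smith_form n N d"
  unfolding smith_form_def by blast

lemma smith_formE: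
  assumes "smith_form n N d"
  obtains U V where "inverse_mats n U V" "N = {x \<in> carrier_vec n. \<forall>i<n. d i dvd (U *\<^sub>v x) $ i}"
  using assms unfolding smith_form_def by blast

lemma smith_form_carrier: "smith_form n (carrier_vec n) (\<lambda>i. 1)"
  by (rule smith_formI[of n "1\<^sub>m n" "1\<^sub>m n"]) (simp_all add: inverse_mats_def)

lemma smith_form_smult:
  assumes "smith_form n N d"
  shows "smith_form n ((\<lambda>x. r \<cdot>\<^sub>v x) ` N) (\<lambda>i. r * d i)"
proof -
  obtain U V where UV: "inverse_mats n U V" and N: "N = {x \<in> carrier_vec n. \<forall>i<n. d i dvd (U *\<^sub>v x) $ i}"
    using assms(1) by (rule smith_formE)
  note U = inverse_matsD(1)[OF UV] and V = inverse_matsD(2)[OF UV]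
  have "(\<lambda>x. r \<cdot>\<^sub>v x) ` N = {x \<in> carrier_vec n. \<forall>i<n. r * d i dvd (U *\<^sub>v x) $ i}"
  proof (intro equalityI subsetI)
    fix x assume "x \<in> (\<lambda>x. r \<cdot>\<^sub>v x) ` N"
    thus "x \<in> {x \<in> carrier_vec n. \<forall>i<n. r * d i dvd (U *\<^sub>v x) $ i}"
      using U N by (auto simp: mult_mat_vec_smult[of U n n] simp del: index_mult_mat_vec)
  next
    fix x assume "x \<in> {x \<in> carrier_vec n. \<forall>i<n. r * d i dvd (U *\<^sub>v x) $ i}"
    hence x: "x \<in> carrier_vec n" and "\<forall>i<n. \<exists>c. (U *\<^sub>v x) $ i = r * d i * c" by (auto simp: dvd_def)
    then obtain c where c: "\<forall>i<n. (U *\<^sub>v x) $ i = r * d i * c i" by metis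
    define y where "y = vec n (\<lambda>i. d i * c i)"
    have y: "y \<in> carrier_vec n" by (simp add: y_def)
    have Ux: "U *\<^sub>v x = r \<cdot>\<^sub>v y"
      using c U by (intro eq_vecI) (simp_all add: y_def mult.assoc del: index_mult_mat_vec)
    have "x = V *\<^sub>v (U *\<^sub>v x)" by (rule inverse_mats_mult_vec[OF inverse_mats_sym[OF UV] x, symmetric])
    also have "\<dots> = r \<cdot>\<^sub>v (V *\<^sub>v y)" unfolding Ux by (rule mult_mat_vec_smult[OF V y])
    finally have "x = r \<cdot>\<^sub>v (V *\<^sub>v y)" .
    moreover have "V *\<^sub>v y \<in> N" using V y inverse_mats_mult_vec[OF UV y] by (simp add: N y_def)
    ultimately show "x \<in> (\<lambda>x. r \<cdot>\<^sub>v x) ` N" by blast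
  qed
  thus ?thesis by (rule smith_formI[OF UV])
qed

lemma inverse_mats_extend:
  assumes "inverse_mats n U V"
  shows "inverse_mats (Suc n) (four_block_mat (1\<^sub>m 1) (0\<^sub>m 1 n) (0\<^sub>m n 1) U)
    (four_block_mat (1\<^sub>m 1) (0\<^sub>m 1 n) (0\<^sub>m n 1) V)"
proof -
  note UV = inverse_matsD[OF assms]
  have "four_block_mat (1\<^sub>m 1) (0\<^sub>m 1 n) (0\<^sub>m n 1) A * four_block_mat (1\<^sub>m 1) (0\<^sub>m 1 n) (0\<^sub>m n 1) B
      = 1\<^sub>m (Suc n)"
    if "A \<in> carrier_mat n n" "B \<in> carrier_mat n n" "A * B = 1\<^sub>m n" for A B :: "'a mat"
    using that four_block_one_mat[of 1 n] by (simp add: mult_four_block_mat[of _ 1 1 _ n _ n _ _ 1 _ n])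
  moreover have "four_block_mat (1\<^sub>m 1) (0\<^sub>m 1 n) (0\<^sub>m n 1) A \<in> carrier_mat (Suc n) (Suc n)"
    if "A \<in> carrier_mat n n" for A :: "'a mat"
    using four_block_carrier_mat[of "1\<^sub>m 1" 1 1 A n n] that by simp
  ultimately show ?thesis using UV by (simp add: inverse_mats_def)
qed

lemma smith_form_vCons:
  assumes "smith_form n N d"
  shows "smith_form (Suc n) (\<Union>t. vCons t ` N) (case_nat 1 d)"
proof -
  obtain U V where UV: "inverse_mats n U V" and N: "N = {x \<in> carrier_vec n. \<forall>i<n. d i dvd (U *\<^sub>v x) $ i}"
    using assms(1) by (rule smith_formE)
  define W where "W = four_block_mat (1\<^sub>m 1) (0\<^sub>m 1 n) (0\<^sub>m n 1) U"
  have U: "U \<in> carrier_mat n n" and W: "W \<in> carrier_mat (Suc n) (Suc n)"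
    using inverse_matsD[OF UV] inverse_matsD[OF inverse_mats_extend[OF UV]] by (simp_all add: W_def)
  have lower: "lower_block W = U" "lower_col W = 0\<^sub>v n"
    using U by (auto simp: lower_block_def lower_col_def W_def intro!: eq_matI eq_vecI)
  have "W *\<^sub>v vCons t x = vCons (scalar_prod (row W 0) (vCons t x)) (U *\<^sub>v x)"
    if x: "x \<in> carrier_vec n" for t x
  proof -
    have "t \<cdot>\<^sub>v 0\<^sub>v n + U *\<^sub>v x = U *\<^sub>v x" using U by (intro eq_vecI) auto
    thus ?thesis unfolding mult_mat_vec_vCons[OF W] lower by simp
  qed
  hence vCons_iff: "(\<forall>i<Suc n. case_nat 1 d i dvd (W *\<^sub>v vCons t x) $ i) \<longleftrightarrow> x \<in> N"
    if "x \<in> carrier_vec n" for t x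
    using that U by (auto simp: N All_less_Suc2 simp del: index_mult_mat_vec)
  have "x \<in> (\<Union>t. vCons t ` N)
      \<longleftrightarrow> x \<in> {x \<in> carrier_vec (Suc n). \<forall>i<Suc n. case_nat 1 d i dvd (W *\<^sub>v x) $ i}" for x
  proof (cases x rule: vec_cases)
    case (vCons t y)
    have "x \<in> (\<Union>t. vCons t ` N) \<longleftrightarrow> y \<in> carrier_vec n \<and> y \<in> N" using N by (auto simp: vCons)
    also have "\<dots> \<longleftrightarrow> x \<in> {x \<in> carrier_vec (Suc n). \<forall>i<Suc n. case_nat 1 d i dvd (W *\<^sub>v x) $ i}"
      unfolding vCons mem_Collect_eq vCons_carrier_vec using vCons_iff by blast
    finally show ?thesis .
  qed (auto simp: N dest: arg_cong[of _ _ dim_vec])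
  hence "(\<Union>t. vCons t ` N) = {x \<in> carrier_vec (Suc n). \<forall>i<Suc n. case_nat 1 d i dvd (W *\<^sub>v x) $ i}"
    by blast
  thus ?thesis unfolding W_def by (rule smith_formI[OF inverse_mats_extend[OF UV]])
qed

lemma smith_form_of_image:
  assumes "smith_form n ((\<lambda>x. P *\<^sub>v x) ` N) d" and N: "N \<subseteq> carrier_vec n" and PQ: "inverse_mats n P Q"
  shows "smith_form n N d"
proof -
  obtain U V where UV: "inverse_mats n U V"
    and PN: "(\<lambda>x. P *\<^sub>v x) ` N = {x \<in> carrier_vec n. \<forall>i<n. d i dvd (U *\<^sub>v x) $ i}"
    using assms(1) by (rule smith_formE)
  note P = inverse_matsD(1)[OF PQ] and U = inverse_matsD(1)[OF UV]
  note inv = inverse_mats_mult_vec[OF inverse_mats_sym[OF PQ]]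
  have "N = {x \<in> carrier_vec n. P *\<^sub>v x \<in> (\<lambda>x. P *\<^sub>v x) ` N}"
  proof (intro equalityI subsetI)
    fix x assume "x \<in> {x \<in> carrier_vec n. P *\<^sub>v x \<in> (\<lambda>x. P *\<^sub>v x) ` N}"
    then obtain y where "x \<in> carrier_vec n" "y \<in> N" "P *\<^sub>v x = P *\<^sub>v y" by blast
    thus "x \<in> N" using inv[of x] inv[of y] N by auto
  qed (use N in auto)
  also have "\<dots> = {x \<in> carrier_vec n. \<forall>i<n. d i dvd ((U * P) *\<^sub>v x) $ i}"
    unfolding PN using P U by (auto simp: assoc_mult_mat_vec[of U n n P n] simp del: index_mult_mat_vec)
  finally show ?thesis by (rule smith_formI[OF inverse_mats_mult[OF UV PQ]])
qed

lemma smith_form_krylov_mod_smult: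
  assumes "A \<in> carrier_mat n n" and "v \<in> carrier_vec n" and "r \<noteq> 0"
    and "smith_form n (krylov_mod q A v) d"
  shows "smith_form n (krylov_mod (r * q) A (r \<cdot>\<^sub>v v)) (\<lambda>i. r * d i)"
  unfolding krylov_mod_smult[OF assms(1-3)] using assms(4) by (rule smith_form_smult)

lemma krylov_mod_deflate:
  assumes PQ: "inverse_mats (Suc n) P Q"
    and A: "A \<in> carrier_mat (Suc n) (Suc n)" and v: "v \<in> carrier_vec (Suc n)"
    and Pv: "(P *\<^sub>v v) vmod q = (s \<cdot>\<^sub>v unit_vec (Suc n) 0) vmod q" and s: "coprime s q"
    and B: "B mmod q = (P * A * Q) mmod q"
  shows "(\<lambda>x. P *\<^sub>v x) ` krylov_mod q A v
    = (\<Union>t. vCons t ` krylov_mod q (lower_block B) (lower_col B))"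
proof -
  have PAQ: "P * A * Q \<in> carrier_mat (Suc n) (Suc n)" using inverse_matsD[OF PQ] A by simp
  hence B_carrier: "B \<in> carrier_mat (Suc n) (Suc n)" using B by (metis mmod_carrier)
  have "(\<lambda>x. P *\<^sub>v x) ` krylov_mod q A v = krylov_mod q (P * A * Q) (P *\<^sub>v v)"
    by (rule krylov_mod_conj[OF PQ A v, symmetric])
  also have "\<dots> = krylov_mod q B (s \<cdot>\<^sub>v unit_vec (Suc n) 0)"
    using Pv B PAQ mult_mat_vec_carrier[OF inverse_matsD(1)[OF PQ] v] by (intro krylov_mod_cong) simp_all
  also have "\<dots> = krylov_mod q B (unit_vec (Suc n) 0)"
    by (rule krylov_mod_unit_smult[OF B_carrier unit_vec_carrier s])
  also have "\<dots> = (\<Union>t. vCons t ` krylov_mod q (lower_block B) (lower_col B))"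
    by (rule krylov_mod_unit_vec[OF B_carrier])
  finally show ?thesis .
qed

lemma smith_form_krylov_mod_deflate:
  assumes PQ: "inverse_mats (Suc n) P Q"
    and A: "A \<in> carrier_mat (Suc n) (Suc n)" and v: "v \<in> carrier_vec (Suc n)"
    and Pv: "(P *\<^sub>v v) vmod q = (s \<cdot>\<^sub>v unit_vec (Suc n) 0) vmod q" and s: "coprime s q"
    and B: "B mmod q = (P * A * Q) mmod q"
    and d: "smith_form n (krylov_mod q (lower_block B) (lower_col B)) d"
  shows "smith_form (Suc n) (krylov_mod q A v) (case_nat 1 d)"
  using smith_form_vCons[OF d, folded krylov_mod_deflate[OF PQ A v Pv s B]]
    krylov_mod_subset_carrier[OF A v] PQ by (rule smith_form_of_image)

lemma case_nat_power: "case_nat 1 (\<lambda>i. x ^ f i) = (\<lambda>i. x ^ case_nat 0 f i)"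
  by (auto split: nat.split)

lemma prime_dvd_vec_cases:
  assumes p: "prime p" and v: "v \<in> carrier_vec n"
  obtains (divisible) w where "w \<in> carrier_vec n" "v = int p \<cdot>\<^sub>v w"
    | (primitive) s where "s < n" "coprime (v $ s) (int p ^ m)"
proof (cases "\<forall>i<n. int p dvd v $ i")
  case True
  thus thesis using divisible dvd_vec_imp_smult[OF v] by blast
next
  case False
  then obtain s where s: "s < n" "\<not> int p dvd v $ s" by blast
  hence "coprime (v $ s) (int p ^ m)" using p by (simp add: coprime_commute prime_imp_coprime)
  thus thesis by (rule primitive[OF s(1)])
qed

lemma krylov_mod_smith_form:
  assumes p: "prime p" and A: "A \<in> carrier_mat n n" and v: "v \<in> carrier_vec n"
  shows "\<exists>\<mu>. smith_form n (krylov_mod (int p ^ m) A v) (\<lambda>i. int p ^ \<mu> i)"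
  using A v
proof (induction "n + m" arbitrary: n m A v rule: less_induct)
  case less
  note A = less.prems(1) and v = less.prems(2)
  show ?case
  proof (cases m)
    case 0
    thus ?thesis using smith_form_carrier krylov_mod_1[OF A v] by (auto intro!: exI[of _ "\<lambda>i. 0"])
  next
    case m: (Suc r)
    from p v show ?thesis
    proof (cases rule: prime_dvd_vec_cases[where m = m])
      case (divisible w)
      obtain \<mu> where "smith_form n (krylov_mod (int p ^ r) A w) (\<lambda>i. int p ^ \<mu> i)"
        using less.hyps[of n r A w] A divisible(1) m by auto
      from smith_form_krylov_mod_smult[OF A divisible(1) _ this, of "int p"]
      have "smith_form n (krylov_mod (int p ^ m) A v) (\<lambda>i. int p ^ Suc (\<mu> i))"
        using p by (simp add: m divisible(2) prime_gt_0_nat)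
      thus ?thesis by (intro exI)
    next
      case (primitive s)
      then obtain k where n: "n = Suc k" by (cases n) auto
      obtain P Q where PQ: "inverse_mats n P Q"
        and Pv: "(P *\<^sub>v v) vmod (int p ^ m) = ((v $ s) \<cdot>\<^sub>v unit_vec n 0) vmod (int p ^ m)"
        using exists_inverse_mats_to_unit_vec_mod[OF v primitive, of 0] n by blast
      let ?B = "P * A * Q"
      have "?B \<in> carrier_mat (Suc k) (Suc k)" using inverse_matsD[OF PQ] A by (simp add: n)
      then obtain \<mu> where
        "smith_form k (krylov_mod (int p ^ m) (lower_block ?B) (lower_col ?B)) (\<lambda>i. int p ^ \<mu> i)"
        using less.hyps[of k m "lower_block ?B" "lower_col ?B"] n by auto
      from smith_form_krylov_mod_deflate[OF PQ[unfolded n] A[unfolded n] v[unfolded n] Pv[unfolded n]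
          primitive(2) refl this]
      show ?thesis unfolding n case_nat_power by (intro exI)
    qed
  qed
qed

subsection \<open>Conjugate partitions\<close>

definition conjugate_partition :: "'i set \<Rightarrow> ('i \<Rightarrow> nat) \<Rightarrow> nat \<Rightarrow> nat" where
  "conjugate_partition I \<mu> k = card {i \<in> I. k < \<mu> i}"

lemma conjugate_partition_le_card: "finite I \<Longrightarrow> conjugate_partition I \<mu> k \<le> card I"
  unfolding conjugate_partition_def by (intro card_mono) auto

lemma conjugate_partition_Suc_shift:
  "conjugate_partition I (\<lambda>i. Suc (\<mu> i)) = case_nat (card I) (conjugate_partition I \<mu>)"
  by (auto simp: conjugate_partition_def split: nat.split)

lemma conjugate_partition_case_nat:
  "conjugate_partition {..<Suc n} (case_nat 0 \<mu>) = conjugate_partition {..<n} \<mu>"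
proof
  fix k
  have "{i \<in> {..<Suc n}. k < case_nat 0 \<mu> i} = Suc ` {i \<in> {..<n}. k < \<mu> i}"
    by (auto simp: image_iff less_Suc_eq_0_disj)
  thus "conjugate_partition {..<Suc n} (case_nat 0 \<mu>) k = conjugate_partition {..<n} \<mu> k"
    by (simp add: conjugate_partition_def card_image)
qed

lemma conjugate_partition_Suc_le:
  "finite I \<Longrightarrow> conjugate_partition I \<mu> (Suc k) \<le> conjugate_partition I \<mu> k"
  unfolding conjugate_partition_def by (intro card_mono) auto

lemma conjugate_partition_eq_0: "\<forall>i\<in>I. \<mu> i \<le> k \<Longrightarrow> conjugate_partition I \<mu> k = 0"
  by (auto simp: conjugate_partition_def card_eq_0_iff not_less)

lemma sum_conjugate_partition:
  assumes "finite J" and "\<And>j. j \<in> J \<Longrightarrow> \<nu> j \<le> m"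
  shows "(\<Sum>k<m. conjugate_partition J \<nu> k) = (\<Sum>j\<in>J. \<nu> j)"
proof -
  have "(\<Sum>k<m. conjugate_partition J \<nu> k) = (\<Sum>k<m. \<Sum>j\<in>J. if k < \<nu> j then 1 else 0)"
    using assms(1) by (simp add: conjugate_partition_def sum.If_cases Int_def)
  also have "\<dots> = (\<Sum>j\<in>J. \<Sum>k<m. if k < \<nu> j then 1 else 0)" by (rule sum.swap)
  also have "\<dots> = (\<Sum>j\<in>J. \<nu> j)"
  proof (rule sum.cong[OF refl])
    fix j assume "j \<in> J"
    hence "{..<m} \<inter> {k. k < \<nu> j} = {..<\<nu> j}" using assms(2)[of j] by auto
    thus "(\<Sum>k<m. if k < \<nu> j then 1 else 0) = \<nu> j" by (simp add: sum.If_cases)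
  qed
  finally show ?thesis .
qed

lemma sum_min_Suc:
  assumes "finite I"
  shows "(\<Sum>i\<in>I. min (Suc k) (\<mu> i)) = (\<Sum>i\<in>I. min k (\<mu> i)) + conjugate_partition I \<mu> k"
proof -
  have "(\<Sum>i\<in>I. min (Suc k) (\<mu> i)) = (\<Sum>i\<in>I. min k (\<mu> i) + (if k < \<mu> i then 1 else 0))"
    by (intro sum.cong) auto
  thus ?thesis using assms by (simp add: conjugate_partition_def sum.distrib sum.If_cases Int_def)
qed

lemma card_fibre_Suc:
  assumes "finite I"
  shows "card {i \<in> I. \<mu> i = Suc k} = conjugate_partition I \<mu> k - conjugate_partition I \<mu> (Suc k)"
proof -
  have "{i \<in> I. \<mu> i = Suc k} = {i \<in> I. k < \<mu> i} - {i \<in> I. Suc k < \<mu> i}" by auto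
  moreover have "card ({i \<in> I. k < \<mu> i} - {i \<in> I. Suc k < \<mu> i})
      = card {i \<in> I. k < \<mu> i} - card {i \<in> I. Suc k < \<mu> i}"
    using assms by (intro card_Diff_subset) auto
  ultimately show ?thesis by (simp add: conjugate_partition_def)
qed

subsection \<open>Sums of cyclic \<open>p\<close>-groups\<close>

lemma sum_group_reindex:
  assumes G: "\<And>i. i \<in> I \<Longrightarrow> group (G i)" and inj: "inj_on \<tau> J" and image: "\<tau> ` J \<subseteq> I"
    and trivial: "\<And>i. i \<in> I - \<tau> ` J \<Longrightarrow> carrier (G i) = {\<one>\<^bsub>G i\<^esub>}"
  shows "sum_group I G \<cong> sum_group J (\<lambda>j. G (\<tau> j))"
proof -
  define f where "f = (\<lambda>x. \<lambda>j\<in>J. x (\<tau> j) :: 'b)"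
  define g where "g = (\<lambda>x. \<lambda>i\<in>I. if i \<in> \<tau> ` J then x (the_inv_into J \<tau> i) else \<one>\<^bsub>G i\<^esub>)"
  have inv: "the_inv_into J \<tau> (\<tau> j) = j" if "j \<in> J" for j
    using inj that by (rule the_inv_into_f_f)
  have carrier_I: "carrier (sum_group I G) = {x \<in> \<Pi>\<^sub>E i\<in>I. carrier (G i). finite {i \<in> I. x i \<noteq> \<one>\<^bsub>G i\<^esub>}}"
    using G by (simp add: carrier_sum_group)
  have carrier_J: "carrier (sum_group J (\<lambda>j. G (\<tau> j)))
      = {x \<in> \<Pi>\<^sub>E j\<in>J. carrier (G (\<tau> j)). finite {j \<in> J. x j \<noteq> \<one>\<^bsub>G (\<tau> j)\<^esub>}}"
    using G image by (intro carrier_sum_group) auto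
  have one: "\<one>\<^bsub>G i\<^esub> \<in> carrier (G i)" if "i \<in> I" for i
    using G[OF that] by (simp add: group.is_monoid)
  have "finite {j \<in> J. x (\<tau> j) \<noteq> \<one>\<^bsub>G (\<tau> j)\<^esub>}" if "finite {i \<in> I. x i \<noteq> \<one>\<^bsub>G i\<^esub>}" for x
    using that by (rule inj_on_finite[of \<tau>, rotated 2]) (use inj image in \<open>auto intro: inj_on_subset\<close>)
  hence f: "f x \<in> carrier (sum_group J (\<lambda>j. G (\<tau> j)))" if "x \<in> carrier (sum_group I G)" for x
    using that image unfolding carrier_I carrier_J by (auto simp: f_def PiE_iff cong: conj_cong)
  have support: "{i \<in> I. g x i \<noteq> \<one>\<^bsub>G i\<^esub>} = \<tau> ` {j \<in> J. x j \<noteq> \<one>\<^bsub>G (\<tau> j)\<^esub>}" for x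
    using image by (auto simp: g_def inv dest: inj_onD[OF inj])
  have "g x \<in> (\<Pi>\<^sub>E i\<in>I. carrier (G i))" if "x \<in> (\<Pi>\<^sub>E j\<in>J. carrier (G (\<tau> j)))" for x
    using that one by (auto simp: g_def inv PiE_iff)
  hence g: "g x \<in> carrier (sum_group I G)" if "x \<in> carrier (sum_group J (\<lambda>j. G (\<tau> j)))" for x
    using that unfolding carrier_I carrier_J mem_Collect_eq support by blast
  have "bij_betw f (carrier (sum_group I G)) (carrier (sum_group J (\<lambda>j. G (\<tau> j))))"
  proof (rule bij_betw_byWitness[where f' = g])
    have "g (f x) i = x i" if "x \<in> carrier (sum_group I G)" for x i
      using that inv trivial[of i] unfolding carrier_I by (auto simp: f_def g_def PiE_iff extensional_def)
    thus "\<forall>x\<in>carrier (sum_group I G). g (f x) = x" by blast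
    have "f (g x) j = x j" if "x \<in> carrier (sum_group J (\<lambda>j. G (\<tau> j)))" for x j
      using that inv image unfolding carrier_J by (auto simp: f_def g_def PiE_iff extensional_def)
    thus "\<forall>x\<in>carrier (sum_group J (\<lambda>j. G (\<tau> j))). f (g x) = x" by blast
  qed (use f g in auto)
  moreover have "f \<in> hom (sum_group I G) (sum_group J (\<lambda>j. G (\<tau> j)))"
    using f image by (intro homI) (auto simp: f_def restrict_def fun_eq_iff)
  ultimately show ?thesis by (auto simp: is_iso_def iso_def)
qed

abbreviation (input) cyclic_sum :: "nat \<Rightarrow> 'i set \<Rightarrow> ('i \<Rightarrow> nat) \<Rightarrow> ('i \<Rightarrow> int) monoid" where
  "cyclic_sum p I \<mu> \<equiv> sum_group I (\<lambda>i. integer_mod_group (p ^ \<mu> i))"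

lemma carrier_cyclic_sum:
  "finite I \<Longrightarrow> p > 0 \<Longrightarrow> carrier (cyclic_sum p I \<mu>) = (\<Pi>\<^sub>E i\<in>I. {0..<int p ^ \<mu> i})"
  by (auto simp: carrier_sum_group carrier_integer_mod_group)

lemma pow_cyclic_sum: "x [^]\<^bsub>cyclic_sum p I \<mu>\<^esub> (k::nat) = (\<lambda>i\<in>I. int k * x i mod int p ^ \<mu> i)"
proof (induction k)
  case 0
  show ?case by simp
next
  case (Suc k)
  thus ?case by (auto simp: algebra_simps mod_add_right_eq intro!: restrict_ext)
qed

lemma multiples_below_mult:
  fixes d e :: int
  assumes "d > 0"
  shows "{a \<in> {0..<d * e}. d dvd a} = (\<lambda>a. d * a) ` {0..<e}"
  using assms by (auto simp: zero_le_mult_iff elim!: dvdE)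

lemma card_torsion_cyclic:
  assumes p: "p > 0"
  shows "card {a \<in> {0..<int p ^ s}. int p ^ s dvd int p ^ k * a} = p ^ min k s"
proof -
  have "int p ^ s = int p ^ (s - k) * int p ^ min k s" by (simp add: min_def flip: power_add)
  moreover have "int p ^ s dvd int p ^ k * a \<longleftrightarrow> int p ^ (s - k) dvd a" for a
  proof (cases "s \<le> k")
    case False
    hence "int p ^ s = int p ^ k * int p ^ (s - k)" by (simp flip: power_add)
    thus ?thesis using p by simp
  qed (simp add: le_imp_power_dvd dvd_mult2)
  ultimately have "{a \<in> {0..<int p ^ s}. int p ^ s dvd int p ^ k * a}
      = (\<lambda>a. int p ^ (s - k) * a) ` {0..<int p ^ min k s}"
    using p multiples_below_mult[of "int p ^ (s - k)" "int p ^ min k s"] by simp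
  moreover have "inj_on (\<lambda>a. int p ^ (s - k) * a) A" for A using p by (auto intro: inj_onI)
  ultimately show ?thesis by (simp add: card_image nat_power_eq)
qed

definition torsion :: "('a, 'b) monoid_scheme \<Rightarrow> nat \<Rightarrow> 'a set" where
  "torsion G k = {x \<in> carrier G. x [^]\<^bsub>G\<^esub> k = \<one>\<^bsub>G\<^esub>}"

lemma card_torsion_cyclic_sum:
  assumes I: "finite I" and p: "p > 0"
  shows "card (torsion (cyclic_sum p I \<mu>) (p ^ k)) = p ^ (\<Sum>i\<in>I. min k (\<mu> i))"
proof -
  have one_iff: "(\<lambda>i\<in>I. int (p ^ k) * x i mod int p ^ \<mu> i) = (\<lambda>i\<in>I. 0)
      \<longleftrightarrow> (\<forall>i\<in>I. int p ^ \<mu> i dvd int p ^ k * x i)" for x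
    by (auto simp: restrict_def fun_eq_iff dvd_eq_mod_eq_0)
  have "torsion (cyclic_sum p I \<mu>) (p ^ k)
      = (\<Pi>\<^sub>E i\<in>I. {a \<in> {0..<int p ^ \<mu> i}. int p ^ \<mu> i dvd int p ^ k * a})"
    unfolding torsion_def carrier_cyclic_sum[OF assms] pow_cyclic_sum one_sum_group
      one_integer_mod_group one_iff
    by (auto simp: PiE_iff extensional_def)
  thus ?thesis by (simp only: card_PiE[OF I] card_torsion_cyclic[OF p] power_sum)
qed

lemma iso_card_torsion:
  assumes "G \<cong> H" "group G" "group H"
  shows "card (torsion G k) = card (torsion H k)"
proof -
  obtain f where f: "f \<in> iso G H" using assms(1) by (auto simp: is_iso_def)
  interpret f: group_hom G H f
    using f assms by (auto simp: group_hom_def group_hom_axioms_def iso_def)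
  have bij: "bij_betw f (carrier G) (carrier H)" using f by (simp add: iso_def)
  have "f x [^]\<^bsub>H\<^esub> k = \<one>\<^bsub>H\<^esub> \<longleftrightarrow> x [^]\<^bsub>G\<^esub> k = \<one>\<^bsub>G\<^esub>" if x: "x \<in> carrier G" for x
  proof -
    have "f (x [^]\<^bsub>G\<^esub> k) = f \<one>\<^bsub>G\<^esub> \<longleftrightarrow> x [^]\<^bsub>G\<^esub> k = \<one>\<^bsub>G\<^esub>"
      using x by (intro inj_on_eq_iff[OF bij_betw_imp_inj_on[OF bij]]) simp_all
    thus ?thesis using x by (simp add: f.hom_nat_pow)
  qed
  hence "bij_betw f (torsion G k) (torsion H k)"
    unfolding torsion_def by (intro bij_betw_Collect[OF bij]) simp
  thus ?thesis by (rule bij_betw_same_card)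
qed

lemma bij_betw_of_equal_card_fibres:
  assumes "finite A" "finite B" and "\<And>y. card {a \<in> A. f a = y} = card {b \<in> B. g b = y}"
  obtains h where "bij_betw h A B" "\<And>a. a \<in> A \<Longrightarrow> g (h a) = f a"
proof -
  have "\<forall>y. \<exists>t. bij_betw t {a \<in> A. f a = y} {b \<in> B. g b = y}"
    using assms by (intro allI finite_same_card_bij) auto
  hence "\<exists>t. \<forall>y. bij_betw (t y) {a \<in> A. f a = y} {b \<in> B. g b = y}" by (rule choice)
  then obtain t where t: "\<And>y. bij_betw (t y) {a \<in> A. f a = y} {b \<in> B. g b = y}" by blast
  define h where "h = (\<lambda>a. t (f a) a)"
  have "bij_betw h (\<Union>y. {a \<in> A. f a = y}) (\<Union>y. {b \<in> B. g b = y})"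
  proof (rule bij_betw_UNION_disjoint)
    show "disjoint_family_on (\<lambda>y. {b \<in> B. g b = y}) UNIV" by (auto simp: disjoint_family_on_def)
    show "bij_betw h {a \<in> A. f a = y} {b \<in> B. g b = y}" for y
      using t[of y] by (subst bij_betw_cong[of _ h "t y"]) (auto simp: h_def)
  qed
  moreover have "(\<Union>y. {a \<in> A. f a = y}) = A" "(\<Union>y. {b \<in> B. g b = y}) = B" by auto
  ultimately have "bij_betw h A B" by simp
  moreover have "g (h a) = f a" if "a \<in> A" for a
    using bij_betw_apply[OF t[of "f a"], of a] that by (simp add: h_def)
  ultimately show thesis by (rule that)
qed

lemma cyclic_sum_iso_iff:
  assumes I: "finite I" and J: "finite J" and p: "p \<ge> 2"
  shows "cyclic_sum p I \<mu> \<cong> cyclic_sum p J \<nu> \<longleftrightarrow> conjugate_partition I \<mu> = conjugate_partition J \<nu>"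
proof
  assume iso: "cyclic_sum p I \<mu> \<cong> cyclic_sum p J \<nu>"
  have "p ^ (\<Sum>i\<in>I. min k (\<mu> i)) = p ^ (\<Sum>j\<in>J. min k (\<nu> j))" for k
    using iso_card_torsion[OF iso, of "p ^ k"] I J p by (simp add: card_torsion_cyclic_sum)
  hence "(\<Sum>i\<in>I. min k (\<mu> i)) = (\<Sum>j\<in>J. min k (\<nu> j))" for k using p by simp
  thus "conjugate_partition I \<mu> = conjugate_partition J \<nu>"
    using sum_min_Suc[OF I, of _ \<mu>] sum_min_Suc[OF J, of _ \<nu>] by (metis add_left_cancel ext)
next
  assume eq: "conjugate_partition I \<mu> = conjugate_partition J \<nu>"
  let ?I = "{i \<in> I. 0 < \<mu> i}" and ?J = "{j \<in> J. 0 < \<nu> j}"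
  have "card {j \<in> ?J. \<nu> j = k} = card {i \<in> ?I. \<mu> i = k}" for k
  proof (cases k)
    case (Suc r)
    hence "{j \<in> ?J. \<nu> j = k} = {j \<in> J. \<nu> j = Suc r}" "{i \<in> ?I. \<mu> i = k} = {i \<in> I. \<mu> i = Suc r}"
      by auto
    thus ?thesis by (simp only: card_fibre_Suc[OF I] card_fibre_Suc[OF J] eq)
  qed (simp cong: conj_cong)
  then obtain \<tau> where \<tau>: "bij_betw \<tau> ?J ?I" "\<And>j. j \<in> ?J \<Longrightarrow> \<mu> (\<tau> j) = \<nu> j"
    using I J by (auto intro: bij_betw_of_equal_card_fibres[of ?J ?I \<nu> \<mu>])
  have "cyclic_sum p J \<nu> \<cong> cyclic_sum p ?J (\<lambda>j. \<nu> (id j))"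
    by (intro sum_group_reindex) (auto simp: carrier_integer_mod_group)
  hence drop: "cyclic_sum p ?J \<nu> \<cong> cyclic_sum p J \<nu>" by (simp add: group.iso_sym)
  have "cyclic_sum p I \<mu> \<cong> cyclic_sum p ?J (\<lambda>j. \<mu> (\<tau> j))"
    using \<tau>(1) by (intro sum_group_reindex) (auto simp: bij_betw_def carrier_integer_mod_group)
  also have "\<dots> \<cong> cyclic_sum p ?J \<nu>" by (intro iso_sum_groupI) (auto simp: \<tau>(2) iso_refl)
  also have "\<dots> \<cong> cyclic_sum p J \<nu>" by (rule drop)
  finally show "cyclic_sum p I \<mu> \<cong> cyclic_sum p J \<nu>" .
qed

subsection \<open>The cokernel of the walk matrix\<close>

lemma FactGroup_FactGroup_iso:
  assumes "H \<lhd> G" and "R \<lhd> G Mod H"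
  shows "G Mod {x \<in> carrier G. H #>\<^bsub>G\<^esub> x \<in> R} \<cong> (G Mod H) Mod R"
proof -
  interpret H: normal H G by fact
  interpret R: normal R "G Mod H" by fact
  interpret QR: group "(G Mod H) Mod R" by (rule R.factorgroup_is_group)
  define f where "f = (\<lambda>x. R #>\<^bsub>G Mod H\<^esub> (H #>\<^bsub>G\<^esub> x))"
  have "f \<in> hom G ((G Mod H) Mod R)"
    using hom_compose[OF H.r_coset_hom_Mod R.r_coset_hom_Mod] by (simp add: f_def comp_def)
  then interpret f: group_hom G "(G Mod H) Mod R" f by unfold_locales
  have "f x = \<one>\<^bsub>(G Mod H) Mod R\<^esub> \<longleftrightarrow> H #>\<^bsub>G\<^esub> x \<in> R" if "x \<in> carrier G" for x
  proof -
    have Hx: "H #>\<^bsub>G\<^esub> x \<in> carrier (G Mod H)" using that by (auto simp: carrier_FactGroup)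
    thus ?thesis
      using R.coset_join1[OF _ Hx R.subgroup_axioms] R.coset_join2[OF Hx R.subgroup_axioms]
      by (auto simp: f_def)
  qed
  hence "kernel G ((G Mod H) Mod R) f = {x \<in> carrier G. H #>\<^bsub>G\<^esub> x \<in> R}"
    unfolding kernel_def by (intro Collect_cong conj_cong refl)
  moreover have "f ` carrier G = carrier ((G Mod H) Mod R)"
    by (auto simp: f_def carrier_FactGroup image_image)
  ultimately show ?thesis using f.FactGroup_iso by simp
qed

lemma FactGroup_multiples_iso_quot_multiples:
  assumes G: "comm_group G" and H: "subgroup H G"
  shows "G Mod (H <#>\<^bsub>G\<^esub> ((\<lambda>x. x [^]\<^bsub>G\<^esub> k) ` carrier G)) \<cong> quot_multiples (G Mod H) k"
proof -
  interpret G: comm_group G by fact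
  interpret H: normal H G using H by (rule G.subgroup_imp_normal)
  interpret Q: comm_group "G Mod H" by (rule G.abelian_FactGroup[OF H])
  define R where "R = (\<lambda>C. C [^]\<^bsub>G Mod H\<^esub> k) ` carrier (G Mod H)"
  have "(\<lambda>C. C [^]\<^bsub>G Mod H\<^esub> k) \<in> hom (G Mod H) (G Mod H)"
    by (intro homI) (simp_all add: Q.nat_pow_distrib del: mult_FactGroup)
  hence "group_hom (G Mod H) (G Mod H) (\<lambda>C. C [^]\<^bsub>G Mod H\<^esub> k)" by unfold_locales
  hence "subgroup R (G Mod H)" unfolding R_def by (rule group_hom.img_is_subgroup)
  hence R: "R \<lhd> G Mod H" by (rule Q.subgroup_imp_normal)
  have R_eq: "R = (\<lambda>z. H #>\<^bsub>G\<^esub> (z [^]\<^bsub>G\<^esub> k)) ` carrier G"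
    by (auto simp: R_def carrier_FactGroup H.FactGroup_pow image_image)
  have "H #>\<^bsub>G\<^esub> x \<in> R \<longleftrightarrow> (\<exists>z\<in>carrier G. x \<in> H #>\<^bsub>G\<^esub> (z [^]\<^bsub>G\<^esub> k))" if x: "x \<in> carrier G" for x
    unfolding R_eq image_iff
    using G.repr_independence[OF _ _ H] G.rcos_self[OF x H] by (metis G.nat_pow_closed)
  moreover have "H #>\<^bsub>G\<^esub> (z [^]\<^bsub>G\<^esub> k) \<subseteq> carrier G" if "z \<in> carrier G" for z
    using that by (intro G.r_coset_subset_G H.subset) simp
  ultimately have "{x \<in> carrier G. H #>\<^bsub>G\<^esub> x \<in> R} = (\<Union>z\<in>carrier G. H #>\<^bsub>G\<^esub> (z [^]\<^bsub>G\<^esub> k))"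
    by blast
  also have "\<dots> = H <#>\<^bsub>G\<^esub> ((\<lambda>x. x [^]\<^bsub>G\<^esub> k) ` carrier G)"
    by (auto simp: set_mult_def r_coset_def)
  finally show ?thesis
    using FactGroup_FactGroup_iso[OF H.normal_axioms R] by (simp add: quot_multiples_def R_def)
qed

lemma pow_monoid_vec:
  "v \<in> carrier_vec n \<Longrightarrow> v [^]\<^bsub>monoid_vec TYPE(int) n\<^esub> (k::nat) = int k \<cdot>\<^sub>v v"
proof (induction k)
  case 0
  have "0\<^sub>v n = 0 \<cdot>\<^sub>v v" using 0 by (intro eq_vecI) auto
  thus ?case by (simp add: monoid_vec_simps)
next
  case (Suc k)
  have "int k \<cdot>\<^sub>v v + v = int (Suc k) \<cdot>\<^sub>v v" using Suc by (intro eq_vecI) (auto simp: algebra_simps)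
  thus ?case using Suc by (simp add: monoid_vec_simps)
qed

lemma vmod_eq_iff_add_smult:
  assumes "x \<in> carrier_vec n" "y \<in> carrier_vec n"
  shows "x vmod q = y vmod q \<longleftrightarrow> (\<exists>z\<in>carrier_vec n. x = y + q \<cdot>\<^sub>v z)"
proof
  assume "x vmod q = y vmod q"
  hence "q dvd (x - y) $ i" if "i < n" for i
    using that assms by (auto simp: vmod_eq_iff cong_iff_dvd_diff)
  then obtain z where z: "z \<in> carrier_vec n" "x - y = q \<cdot>\<^sub>v z"
    using assms by (metis dvd_vec_imp_smult minus_carrier_vec)
  moreover have "x = y + (x - y)" using assms by (intro eq_vecI) auto
  ultimately show "\<exists>z\<in>carrier_vec n. x = y + q \<cdot>\<^sub>v z" by auto
qed (use assms in \<open>auto simp: vmod_eq_iff cong_def\<close>)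

lemma pow_mat_Suc_left:
  fixes A :: "'a :: semiring_1 mat"
  assumes A: "A \<in> carrier_mat n n"
  shows "A ^\<^sub>m Suc k = A * A ^\<^sub>m k"
proof (induction k)
  case (Suc k)
  have "A ^\<^sub>m Suc (Suc k) = A * A ^\<^sub>m k * A" using Suc by simp
  thus ?case using A by (simp add: assoc_mult_mat[of _ n n _ n _ n])
qed (use A in simp)

lemma mat_of_cols_Cons_mult_vCons:
  fixes w :: "'a :: comm_semiring_0 vec"
  assumes "w \<in> carrier_vec n" "c \<in> carrier_vec (length ws)"
  shows "mat_of_cols n (w # ws) *\<^sub>v vCons t c = t \<cdot>\<^sub>v w + mat_of_cols n ws *\<^sub>v c"
proof (rule eq_vecI)
  fix i assume "i < dim_vec (t \<cdot>\<^sub>v w + mat_of_cols n ws *\<^sub>v c)"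
  hence i: "i < n" by simp
  hence "row (mat_of_cols n (w # ws)) i = vCons (w $ i) (row (mat_of_cols n ws) i)"
    by (intro eq_vecI) (auto simp: vec_index_vCons mat_of_cols_index nth_Cons')
  thus "(mat_of_cols n (w # ws) *\<^sub>v vCons t c) $ i = (t \<cdot>\<^sub>v w + mat_of_cols n ws *\<^sub>v c) $ i"
    using i assms by (simp add: mult.commute)
qed simp

lemma mat_of_cols_map_mult_mat_vec:
  assumes A: "A \<in> carrier_mat n nc" and ws: "\<And>w. w \<in> set ws \<Longrightarrow> w \<in> carrier_vec nc"
  shows "mat_of_cols n (map (\<lambda>w. A *\<^sub>v w) ws) = A * mat_of_cols nc ws"
  using A ws by (intro eq_matI) (auto simp: mat_of_cols_index)

lemma carrier_vec_Suc: "carrier_vec (Suc n) = (\<Union>t. vCons t ` carrier_vec n)"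
proof (rule Set.set_eqI)
  show "x \<in> carrier_vec (Suc n) \<longleftrightarrow> x \<in> (\<Union>t. vCons t ` carrier_vec n)" for x :: "'a vec"
    by (cases x rule: vec_cases) (auto dest: arg_cong[of _ _ dim_vec])
qed

lemma carrier_vec_0: "carrier_vec 0 = {0\<^sub>v 0}"
  by (auto intro: eq_vecI)

lemma map_pow_mat_mult_vec_upt_Suc:
  fixes A :: "'a :: comm_semiring_1 mat"
  assumes A: "A \<in> carrier_mat n n" and v: "v \<in> carrier_vec n"
  shows "map (\<lambda>j. A ^\<^sub>m j *\<^sub>v v) [0..<Suc k]
    = v # map (\<lambda>w. A *\<^sub>v w) (map (\<lambda>j. A ^\<^sub>m j *\<^sub>v v) [0..<k])"
proof -
  have "A ^\<^sub>m Suc j *\<^sub>v v = A *\<^sub>v (A ^\<^sub>m j *\<^sub>v v)" for j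
    unfolding pow_mat_Suc_left[OF A] by (rule assoc_mult_mat_vec[OF A pow_carrier_mat[OF A] v])
  thus ?thesis using A v unfolding upt_conv_Cons[OF zero_less_Suc] map_Suc_upt[symmetric]
    by (simp add: comp_def del: pow_mat.simps(2))
qed

lemma krylov_eq_range:
  assumes A: "A \<in> carrier_mat n n" and v: "v \<in> carrier_vec n"
  shows "krylov A v k
    = (\<lambda>c. mat_of_cols n (map (\<lambda>j. A ^\<^sub>m j *\<^sub>v v) [0..<k]) *\<^sub>v c) ` carrier_vec k"
proof (induction k)
  case 0
  have "mat_of_cols n [] *\<^sub>v 0\<^sub>v 0 = (0\<^sub>v n :: int vec)"
    by (intro eq_vecI) (simp_all add: scalar_prod_def)
  thus ?case using v by (simp add: carrier_vec_0)
next
  case (Suc k)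
  define W where "W = mat_of_cols n (map (\<lambda>j. A ^\<^sub>m j *\<^sub>v v) [0..<k])"
  have W: "W \<in> carrier_mat n k" unfolding W_def by (rule carrier_matI) simp_all
  have "A ^\<^sub>m j *\<^sub>v v \<in> carrier_vec n" for j using A v by (intro mult_mat_vec_carrier) simp_all
  hence "mat_of_cols n (map (\<lambda>w. A *\<^sub>v w) (map (\<lambda>j. A ^\<^sub>m j *\<^sub>v v) [0..<k])) = A * W"
    unfolding W_def by (intro mat_of_cols_map_mult_mat_vec[OF A]) auto
  hence "mat_of_cols n (map (\<lambda>j. A ^\<^sub>m j *\<^sub>v v) [0..<Suc k]) *\<^sub>v vCons t c
      = t \<cdot>\<^sub>v v + A *\<^sub>v (W *\<^sub>v c)" if "c \<in> carrier_vec k" for t c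
    unfolding map_pow_mat_mult_vec_upt_Suc[OF A v] using that A v W
    by (subst mat_of_cols_Cons_mult_vCons)
      (simp_all only: length_map length_upt diff_zero assoc_mult_mat_vec[OF A W])
  hence "(\<lambda>c. mat_of_cols n (map (\<lambda>j. A ^\<^sub>m j *\<^sub>v v) [0..<Suc k]) *\<^sub>v c) ` carrier_vec (Suc k)
      = (\<Union>t. (\<lambda>c. t \<cdot>\<^sub>v v + A *\<^sub>v (W *\<^sub>v c)) ` carrier_vec k)"
    by (simp add: carrier_vec_Suc image_UN image_image cong: image_cong_simp)
  thus ?case by (simp add: Suc image_image W_def)
qed

lemma krylov_mod_eq_set_mult:
  assumes A: "A \<in> carrier_mat n n" and v: "v \<in> carrier_vec n"
  defines "G \<equiv> monoid_vec TYPE(int) n"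
  shows "krylov_mod (int q) A v = krylov A v n <#>\<^bsub>G\<^esub> ((\<lambda>x. x [^]\<^bsub>G\<^esub> q) ` carrier G)"
proof -
  have "krylov_mod (int q) A v = {x. \<exists>y\<in>krylov A v n. \<exists>z\<in>carrier_vec n. x = y + int q \<cdot>\<^sub>v z}"
  proof (intro equalityI subsetI)
    fix x assume x: "x \<in> krylov_mod (int q) A v"
    then obtain y where "y \<in> krylov A v n" "x vmod int q = y vmod int q"
      using v by (auto simp: krylov_mod_def)
    thus "x \<in> {x. \<exists>y\<in>krylov A v n. \<exists>z\<in>carrier_vec n. x = y + int q \<cdot>\<^sub>v z}"
      using krylov_mod_subset_carrier[OF A v] krylov_subset_carrier[OF A v] x
        vmod_eq_iff_add_smult[of x n y] by blast
  next
    fix x assume "x \<in> {x. \<exists>y\<in>krylov A v n. \<exists>z\<in>carrier_vec n. x = y + int q \<cdot>\<^sub>v z}"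
    then obtain y z where y: "y \<in> krylov A v n" and z: "z \<in> carrier_vec n" and x: "x = y + int q \<cdot>\<^sub>v z"
      by blast
    have "y \<in> carrier_vec n" using y krylov_subset_carrier[OF A v] by blast
    moreover from this have "x \<in> carrier_vec n" using x z by simp
    ultimately have "x vmod int q = y vmod int q" using vmod_eq_iff_add_smult x z by blast
    thus "x \<in> krylov_mod (int q) A v" using v y by (auto simp: krylov_mod_def)
  qed
  also have "\<dots> = {x. \<exists>y\<in>krylov A v n. \<exists>z\<in>carrier_vec n. x = y + z [^]\<^bsub>G\<^esub> q}"
    unfolding G_def by (simp only: pow_monoid_vec cong: bex_cong)
  also have "\<dots> = krylov A v n <#>\<^bsub>G\<^esub> ((\<lambda>x. x [^]\<^bsub>G\<^esub> q) ` carrier G)"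
    unfolding G_def set_mult_def monoid_vec_simps by blast
  finally show ?thesis .
qed

lemma FactGroup_krylov_mod_iso_coker_walk_matrix:
  assumes X: "X \<in> carrier_mat n n" and b: "b \<in> carrier_vec n"
  shows "monoid_vec TYPE(int) n Mod krylov_mod (int q) X b \<cong> quot_multiples (coker (walk_matrix X b)) q"
proof -
  let ?G = "monoid_vec TYPE(int) n" and ?W = "walk_matrix X b"
  have W: "?W \<in> carrier_mat n n" using b by (auto simp: walk_matrix_def)
  interpret G: comm_group ?G by (rule comm_group_vec)
  have krylov: "krylov X b n = (\<lambda>c. ?W *\<^sub>v c) ` carrier ?G"
    using krylov_eq_range[OF X b, of n] b by (simp add: walk_matrix_def monoid_vec_simps)
  have "(\<lambda>v. ?W *\<^sub>v v) \<in> hom ?G ?G"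
    using W mult_add_distrib_mat_vec[OF W] by (auto simp: hom_def monoid_vec_simps)
  hence "group_hom ?G ?G (\<lambda>v. ?W *\<^sub>v v)" by unfold_locales
  hence "subgroup (krylov X b n) ?G" unfolding krylov by (rule group_hom.img_is_subgroup)
  moreover have "coker ?W = ?G Mod krylov X b n" using W by (auto simp: coker_def krylov monoid_vec_simps)
  ultimately show ?thesis
    using FactGroup_multiples_iso_quot_multiples[OF comm_group_vec, of "krylov X b n" n q]
    by (simp add: krylov_mod_eq_set_mult[OF X b])
qed

lemma smith_form_FactGroup:
  assumes "smith_form n N (\<lambda>i. int (d i))"
  shows "monoid_vec TYPE(int) n Mod N \<cong> sum_group {..<n} (\<lambda>i. integer_mod_group (d i))"
    and "group (monoid_vec TYPE(int) n Mod N)"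
proof -
  let ?G = "monoid_vec TYPE(int) n" and ?S = "sum_group {..<n} (\<lambda>i. integer_mod_group (d i))"
  obtain U V where UV: "inverse_mats n U V"
    and N: "N = {x \<in> carrier_vec n. \<forall>i<n. int (d i) dvd (U *\<^sub>v x) $ i}"
    using assms by (rule smith_formE)
  note U = inverse_matsD(1)[OF UV] and V = inverse_matsD(2)[OF UV]
  have carrier: "carrier ?S = (\<Pi>\<^sub>E i\<in>{..<n}. carrier (integer_mod_group (d i)))"
    by (simp add: carrier_sum_group)
  define f where "f = (\<lambda>x. \<lambda>i\<in>{..<n}. (U *\<^sub>v x) $ i mod int (d i))"
  have f: "f x \<in> carrier ?S" for x
    unfolding carrier f_def by (auto simp: carrier_integer_mod_group simp del: index_mult_mat_vec)
  interpret G: comm_group ?G by (rule comm_group_vec)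
  interpret S: group ?S by simp
  have "f \<in> hom ?G ?S"
  proof (rule homI)
    fix x y assume "x \<in> carrier ?G" "y \<in> carrier ?G"
    hence "U *\<^sub>v (x + y) = U *\<^sub>v x + U *\<^sub>v y" "dim_vec (U *\<^sub>v y) = n"
      using U by (simp_all add: monoid_vec_simps mult_add_distrib_mat_vec)
    thus "f (x \<otimes>\<^bsub>?G\<^esub> y) = f x \<otimes>\<^bsub>?S\<^esub> f y"
      by (auto simp: f_def monoid_vec_simps mod_add_eq intro!: restrict_ext simp del: index_mult_mat_vec)
  qed (rule f)
  then interpret f: group_hom ?G ?S f by unfold_locales
  have "y \<in> f ` carrier ?G" if y: "y \<in> carrier ?S" for y
  proof
    have "U *\<^sub>v (V *\<^sub>v vec n y) = vec n y" by (simp add: inverse_mats_mult_vec[OF UV])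
    moreover have "y i mod int (d i) = y i" if "i < n" for i
      using PiE_mem[OF y[unfolded carrier], of i] that
      by (auto simp: carrier_integer_mod_group split: if_splits)
    ultimately show "y = f (V *\<^sub>v vec n y)"
      using y by (auto simp: f_def carrier PiE_iff extensional_def fun_eq_iff simp del: index_mult_mat_vec)
  qed (use V in \<open>simp add: monoid_vec_simps\<close>)
  hence "f ` carrier ?G = carrier ?S" using f by auto
  moreover have "kernel ?G ?S f = N"
    by (auto simp: kernel_def N f_def monoid_vec_simps restrict_def fun_eq_iff dvd_eq_mod_eq_0
        simp del: index_mult_mat_vec)
  ultimately show "?G Mod N \<cong> ?S" using f.FactGroup_iso by simp
  show "group (?G Mod N)"
    using normal.factorgroup_is_group[OF f.normal_kernel] \<open>kernel ?G ?S f = N\<close> by simp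
qed

lemma smith_form_unique:
  assumes p: "p \<ge> 2" and \<mu>: "smith_form n N (\<lambda>i. int p ^ \<mu> i)" and \<nu>: "smith_form n N (\<lambda>i. int p ^ \<nu> i)"
  shows "conjugate_partition {..<n} \<mu> = conjugate_partition {..<n} \<nu>"
proof -
  have "smith_form n N (\<lambda>i. int (p ^ \<mu> i))" "smith_form n N (\<lambda>i. int (p ^ \<nu> i))" using \<mu> \<nu> by simp_all
  note quotients = this[THEN smith_form_FactGroup(1)] this(1)[THEN smith_form_FactGroup(2)]
  have "cyclic_sum p {..<n} \<mu> \<cong> cyclic_sum p {..<n} \<nu>"
    using iso_trans[OF group.iso_sym[OF quotients(3,1)] quotients(2)] .
  thus ?thesis using p by (simp add: cyclic_sum_iso_iff)
qed

text \<open>The number of cyclic summands of order exceeding \<open>p\<^sup>k\<close> in \<open>\<int>\<^sup>n / krylov_mod p\<^sup>m A v\<close>, as a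
  function of \<open>k\<close>.\<close>

definition krylov_type :: "nat \<Rightarrow> nat \<Rightarrow> int mat \<Rightarrow> int vec \<Rightarrow> nat \<Rightarrow> nat" where
  "krylov_type p m A v = conjugate_partition {..<dim_vec v}
    (SOME \<mu>. smith_form (dim_vec v) (krylov_mod (int p ^ m) A v) (\<lambda>i. int p ^ \<mu> i))"

lemma krylov_type_eq:
  assumes "p \<ge> 2" and v: "v \<in> carrier_vec n"
    and \<mu>: "smith_form n (krylov_mod (int p ^ m) A v) (\<lambda>i. int p ^ \<mu> i)"
  shows "krylov_type p m A v = conjugate_partition {..<n} \<mu>"
proof -
  have dim: "dim_vec v = n" using v by simp
  have "smith_form n (krylov_mod (int p ^ m) A v)
      (\<lambda>i. int p ^ (SOME \<mu>. smith_form n (krylov_mod (int p ^ m) A v) (\<lambda>i. int p ^ \<mu> i)) i)"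
    by (rule someI[of "\<lambda>\<mu>. smith_form n (krylov_mod (int p ^ m) A v) (\<lambda>i. int p ^ \<mu> i)", OF \<mu>])
  thus ?thesis unfolding krylov_type_def dim by (rule smith_form_unique[OF assms(1) _ \<mu>])
qed

lemma coker_walk_matrix_iso_iff_krylov_type:
  assumes p: "prime p" and X: "X \<in> carrier_mat n n" and b: "b \<in> carrier_vec n" and J: "finite J"
  shows "quot_multiples (coker (walk_matrix X b)) (p ^ m) \<cong> cyclic_sum p J \<nu>
    \<longleftrightarrow> krylov_type p m X b = conjugate_partition J \<nu>"
proof -
  let ?C = "quot_multiples (coker (walk_matrix X b)) (p ^ m)"
  let ?Q = "monoid_vec TYPE(int) n Mod krylov_mod (int p ^ m) X b"
  have p2: "p \<ge> 2" using p by (rule prime_ge_2_nat)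
  obtain \<mu> where \<mu>: "smith_form n (krylov_mod (int p ^ m) X b) (\<lambda>i. int p ^ \<mu> i)"
    using krylov_mod_smith_form[OF p X b] by blast
  have Q: "group ?Q" "?Q \<cong> cyclic_sum p {..<n} \<mu>"
    using smith_form_FactGroup[of n _ "\<lambda>i. p ^ \<mu> i"] \<mu> by simp_all
  have QC: "?Q \<cong> ?C" using FactGroup_krylov_mod_iso_coker_walk_matrix[OF X b, of "p ^ m"] by simp
  have "?C \<cong> cyclic_sum p J \<nu> \<longleftrightarrow> ?Q \<cong> cyclic_sum p J \<nu>"
    using iso_trans[OF QC] iso_trans[OF group.iso_sym[OF Q(1) QC]] by blast
  also have "\<dots> \<longleftrightarrow> cyclic_sum p {..<n} \<mu> \<cong> cyclic_sum p J \<nu>"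
    using iso_trans[OF Q(2)] iso_trans[OF group.iso_sym[OF Q]] by blast
  also have "\<dots> \<longleftrightarrow> krylov_type p m X b = conjugate_partition J \<nu>"
    using J by (simp add: cyclic_sum_iso_iff[OF _ _ p2] krylov_type_eq[OF p2 b \<mu>])
  finally show ?thesis .
qed

lemma krylov_type_le_dim: "krylov_type p m A v k \<le> dim_vec v"
  using conjugate_partition_le_card[of "{..<dim_vec v}"] by (simp add: krylov_type_def)

lemma krylov_type_mmod:
  assumes "A \<in> carrier_mat n n" and "v \<in> carrier_vec n"
  shows "krylov_type p m (A mmod int p ^ m) v = krylov_type p m A v"
  unfolding krylov_type_def using assms krylov_mod_cong[of "A mmod int p ^ m" "int p ^ m" A v v n] by simp

lemma krylov_type_0:
  assumes "p \<ge> 2" and "A \<in> carrier_mat n n" and "v \<in> carrier_vec n"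
  shows "krylov_type p 0 A v = (\<lambda>k. 0)"
proof -
  have "smith_form n (krylov_mod (int p ^ 0) A v) (\<lambda>i. int p ^ 0)"
    using smith_form_carrier krylov_mod_1[OF assms(2,3)] by simp
  from krylov_type_eq[OF assms(1,3) this] show ?thesis by (simp add: conjugate_partition_def fun_eq_iff)
qed

lemma krylov_type_smult:
  assumes p: "prime p" and A: "A \<in> carrier_mat n n" and v: "v \<in> carrier_vec n"
  shows "krylov_type p (Suc m) A (int p \<cdot>\<^sub>v v) = case_nat n (krylov_type p m A v)"
proof -
  obtain \<mu> where \<mu>: "smith_form n (krylov_mod (int p ^ m) A v) (\<lambda>i. int p ^ \<mu> i)"
    using krylov_mod_smith_form[OF p A v] by blast
  have "smith_form n (krylov_mod (int p ^ Suc m) A (int p \<cdot>\<^sub>v v)) (\<lambda>i. int p ^ Suc (\<mu> i))"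
    using smith_form_krylov_mod_smult[OF A v _ \<mu>, of "int p"] p by (simp add: prime_gt_0_nat)
  hence "krylov_type p (Suc m) A (int p \<cdot>\<^sub>v v) = conjugate_partition {..<n} (\<lambda>i. Suc (\<mu> i))"
    using v by (intro krylov_type_eq[OF prime_ge_2_nat[OF p]]) simp_all
  thus ?thesis
    by (simp add: conjugate_partition_Suc_shift krylov_type_eq[OF prime_ge_2_nat[OF p] v \<mu>])
qed

lemma krylov_type_deflate:
  assumes p: "prime p" and PQ: "inverse_mats (Suc n) P Q"
    and A: "A \<in> carrier_mat (Suc n) (Suc n)" and v: "v \<in> carrier_vec (Suc n)"
    and Pv: "(P *\<^sub>v v) vmod (int p ^ m) = (s \<cdot>\<^sub>v unit_vec (Suc n) 0) vmod (int p ^ m)"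
    and s: "coprime s (int p ^ m)" and B: "B mmod int p ^ m = (P * A * Q) mmod int p ^ m"
  shows "krylov_type p m A v = krylov_type p m (lower_block B) (lower_col B)"
proof -
  have "P * A * Q \<in> carrier_mat (Suc n) (Suc n)" using inverse_matsD[OF PQ] A by simp
  hence B_carrier: "B \<in> carrier_mat (Suc n) (Suc n)" using B by (metis mmod_carrier)
  note lower = lower_block_carrier[OF B_carrier] lower_col_carrier[OF B_carrier]
  obtain \<mu> where \<mu>: "smith_form n (krylov_mod (int p ^ m) (lower_block B) (lower_col B)) (\<lambda>i. int p ^ \<mu> i)"
    using krylov_mod_smith_form[OF p lower] by blast
  have "smith_form (Suc n) (krylov_mod (int p ^ m) A v) (\<lambda>i. int p ^ case_nat 0 \<mu> i)"
    using smith_form_krylov_mod_deflate[OF PQ A v Pv s B \<mu>] unfolding case_nat_power .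
  from krylov_type_eq[OF prime_ge_2_nat[OF p] v this] show ?thesis
    by (simp add: conjugate_partition_case_nat krylov_type_eq[OF prime_ge_2_nat[OF p] lower(2) \<mu>])
qed

subsection \<open>Random matrices with independent entries\<close>

definition iid_mat :: "nat \<Rightarrow> nat \<Rightarrow> 'a::zero pmf \<Rightarrow> 'a mat pmf" where
  "iid_mat nr nc D = map_pmf (mat nr nc) (Pi_pmf ({..<nr} \<times> {..<nc}) 0 (\<lambda>_. D))"

definition iid_vec :: "nat \<Rightarrow> 'a::zero pmf \<Rightarrow> 'a vec pmf" where
  "iid_vec n D = map_pmf (vec n) (Pi_pmf {..<n} 0 (\<lambda>_. D))"

lemma set_iid_mat: "set_pmf (iid_mat nr nc D) \<subseteq> carrier_mat nr nc"
  by (auto simp: iid_mat_def)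

lemma set_iid_vec: "set_pmf (iid_vec n D) \<subseteq> carrier_vec n"
  by (auto simp: iid_vec_def)

lemma map_mat_iid_mat:
  assumes "f 0 = 0"
  shows "map_pmf (map_mat f) (iid_mat nr nc D) = iid_mat nr nc (map_pmf f D)"
proof -
  have "map_mat f (mat nr nc h) = mat nr nc (f \<circ> h)" for h by (intro eq_matI) auto
  thus ?thesis by (simp add: iid_mat_def Pi_pmf_map[of _ f, OF _ assms] map_pmf_comp)
qed

lemma Pi_pmf_embed:
  assumes J: "finite J" and \<sigma>: "inj \<sigma>" "\<sigma> ` I \<subseteq> J"
  shows "map_pmf (\<lambda>f i. if i \<in> I then f (\<sigma> i) else d) (Pi_pmf J d (\<lambda>_. D)) = Pi_pmf I d (\<lambda>_. D)"
proof -
  have I: "finite I" using J \<sigma> by (meson finite_imageD finite_subset inj_on_subset subset_UNIV)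
  have bij: "bij_betw \<sigma> I (\<sigma> ` I)" using inj_on_subset[OF \<sigma>(1) subset_UNIV] by (simp add: bij_betw_def)
  have "Pi_pmf I d (\<lambda>_. D) = map_pmf (\<lambda>f. f \<circ> \<sigma>) (Pi_pmf (\<sigma> ` I) d (\<lambda>_. D))"
    using \<sigma>(1) by (intro Pi_pmf_bij_betw[OF I bij]) (auto dest: injD)
  also have "\<dots> = map_pmf (\<lambda>f i. if \<sigma> i \<in> \<sigma> ` I then f (\<sigma> i) else d) (Pi_pmf J d (\<lambda>_. D))"
    by (simp add: Pi_pmf_subset[OF J \<sigma>(2)] map_pmf_comp comp_def)
  finally show ?thesis using \<sigma>(1) by (simp add: inj_image_mem_iff)
qed

lemma lower_iid_mat:
  "map_pmf (\<lambda>A. (lower_col A, lower_block A)) (iid_mat (Suc nr) (Suc nc) D)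
    = pair_pmf (iid_vec nr D) (iid_mat nr nc D)"
proof -
  let ?J = "{..<Suc nr} \<times> {..<Suc nc}" and ?\<sigma> = "\<lambda>i. (Suc i, 0 :: nat)" and ?\<tau> = "\<lambda>(i, j). (Suc i, Suc j)"
  let ?C = "?\<sigma> ` {..<nr}"
  let ?pair = "pair_pmf (Pi_pmf ?C 0 (\<lambda>_. D)) (Pi_pmf (?J - ?C) 0 (\<lambda>_. D))"
  let ?glue = "\<lambda>(f, g) ij. if ij \<in> ?C then f ij else g ij"
  let ?col = "\<lambda>f. vec nr (\<lambda>i. if i \<in> {..<nr} then f (?\<sigma> i) else 0)"
  let ?block = "\<lambda>g. mat nr nc (\<lambda>ij. if ij \<in> {..<nr} \<times> {..<nc} then g (?\<tau> ij) else 0)"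
  have "Pi_pmf (?C \<union> (?J - ?C)) 0 (\<lambda>_. D) = map_pmf ?glue ?pair"
    by (rule Pi_pmf_union) auto
  moreover have "?C \<union> (?J - ?C) = ?J" by auto
  ultimately have "map_pmf (\<lambda>A. (lower_col A, lower_block A)) (iid_mat (Suc nr) (Suc nc) D)
      = map_pmf (\<lambda>fg. (lower_col (mat (Suc nr) (Suc nc) (?glue fg)),
          lower_block (mat (Suc nr) (Suc nc) (?glue fg)))) ?pair"
    by (simp only: iid_mat_def map_pmf_comp)
  also have "\<dots> = map_pmf (\<lambda>(f, g). (?col f, ?block g)) ?pair"
    by (intro map_pmf_cong refl) (auto simp: lower_col_def lower_block_def intro!: eq_vecI eq_matI)
  also have "\<dots> = pair_pmf (map_pmf ?col (Pi_pmf ?C 0 (\<lambda>_. D)))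
      (map_pmf ?block (Pi_pmf (?J - ?C) 0 (\<lambda>_. D)))"
    by (rule map_pair)
  also have "map_pmf ?col (Pi_pmf ?C 0 (\<lambda>_. D)) = iid_vec nr D"
    unfolding iid_vec_def
    by (subst Pi_pmf_embed[of ?C ?\<sigma>, symmetric]) (auto simp: inj_on_def map_pmf_comp)
  also have "map_pmf ?block (Pi_pmf (?J - ?C) 0 (\<lambda>_. D)) = iid_mat nr nc D"
    unfolding iid_mat_def
    by (subst Pi_pmf_embed[of "?J - ?C" ?\<tau>, symmetric]) (auto simp: inj_on_def map_pmf_comp)
  finally show ?thesis .
qed

lemma map_Pi_pmf_of_set:
  assumes I: "finite I" and S: "finite S" "S \<noteq> {}" and F: "bij_betw F (PiE_dflt I d (\<lambda>_. S)) T"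
  shows "map_pmf F (Pi_pmf I d (\<lambda>_. pmf_of_set S)) = pmf_of_set T"
    and "finite T" and "T \<noteq> {}" and "card T = card S ^ card I"
proof -
  let ?F = "PiE_dflt I d (\<lambda>_. S)"
  have PiE: "finite ?F" "?F \<noteq> {}" using I S by (auto intro: finite_PiE_dflt)
  have T: "T = F ` ?F" and inj: "inj_on F ?F" using F by (simp_all add: bij_betw_def)
  show "map_pmf F (Pi_pmf I d (\<lambda>_. pmf_of_set S)) = pmf_of_set T"
    unfolding T map_pmf_of_set_inj[OF inj PiE(2,1), symmetric] using I S by (subst Pi_pmf_of_set) simp_all
  show "finite T" "T \<noteq> {}" unfolding T using PiE by simp_all
  show "card T = card S ^ card I"
    unfolding T card_image[OF inj] using I S by (simp add: card_PiE_dflt)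
qed

lemma iid_mat_pmf_of_set:
  fixes nr nc :: nat
  assumes "finite S" "S \<noteq> {}"
  defines "T \<equiv> {A \<in> carrier_mat nr nc. \<forall>i<nr. \<forall>j<nc. A $$ (i, j) \<in> S}"
  shows "iid_mat nr nc (pmf_of_set S) = pmf_of_set T" and "finite T" and "T \<noteq> {}"
proof -
  let ?I = "{..<nr} \<times> {..<nc}"
  have "bij_betw (mat nr nc) (PiE_dflt ?I 0 (\<lambda>_. S)) T"
    unfolding T_def
    by (rule bij_betw_byWitness[where f' = "\<lambda>A ij. if ij \<in> ?I then A $$ ij else 0"])
      (auto simp: PiE_dflt_def intro!: eq_matI)
  thus "iid_mat nr nc (pmf_of_set S) = pmf_of_set T" "finite T" "T \<noteq> {}"
    unfolding iid_mat_def using assms(1,2) map_Pi_pmf_of_set[of ?I S "mat nr nc" 0 T] by simp_all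
qed

lemma iid_vec_pmf_of_set:
  fixes n :: nat
  assumes "finite S" "S \<noteq> {}"
  defines "T \<equiv> {v \<in> carrier_vec n. \<forall>i<n. v $ i \<in> S}"
  shows "iid_vec n (pmf_of_set S) = pmf_of_set T" and "finite T" and "card T = card S ^ n"
proof -
  have "bij_betw (vec n) (PiE_dflt {..<n} 0 (\<lambda>_. S)) T"
    unfolding T_def
    by (rule bij_betw_byWitness[where f' = "\<lambda>v i. if i \<in> {..<n} then v $ i else 0"])
      (auto simp: PiE_dflt_def intro!: eq_vecI)
  thus "iid_vec n (pmf_of_set S) = pmf_of_set T" "finite T" "card T = card S ^ n"
    unfolding iid_vec_def using assms(1,2) map_Pi_pmf_of_set[of "{..<n}" S "vec n" 0 T] by simp_all
qed

lemma (in prob_space) distr_restrict_eq_Pi_pmf: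
  fixes X :: "'i \<Rightarrow> 'a \<Rightarrow> 'b :: countable"
  assumes I: "finite I" "I \<noteq> {}" and indep: "indep_vars (\<lambda>_. count_space UNIV) X I"
    and law: "\<And>i. i \<in> I \<Longrightarrow> distr M (count_space UNIV) (X i) = measure_pmf (D i)"
  shows "distr M (\<Pi>\<^sub>M i\<in>I. count_space UNIV) (\<lambda>\<omega>. \<lambda>i\<in>I. X i \<omega>)
    = distr (measure_pmf (Pi_pmf I d D)) (\<Pi>\<^sub>M i\<in>I. count_space UNIV) (\<lambda>f. restrict f I)"
proof -
  let ?C = "count_space (UNIV :: 'b set)" and ?\<Pi> = "Pi_pmf I d D"
  have X: "X i \<in> measurable M ?C" if "i \<in> I" for i
    using indep that by (auto simp: indep_vars_def)
  have component: "distr (measure_pmf ?\<Pi>) ?C (\<lambda>f. f i) = measure_pmf (D i)" if "i \<in> I" for i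
    using Pi_pmf_component[OF I(1), of i d D] that by (simp add: map_pmf_rep_eq[symmetric])
  have "distr M (\<Pi>\<^sub>M i\<in>I. ?C) (\<lambda>\<omega>. \<lambda>i\<in>I. X i \<omega>) = (\<Pi>\<^sub>M i\<in>I. distr M ?C (X i))"
    using indep_vars_iff_distr_eq_PiM'[OF I(2) X] indep by simp
  also have "\<dots> = (\<Pi>\<^sub>M i\<in>I. distr (measure_pmf ?\<Pi>) ?C (\<lambda>f. f i))"
    using law component by (intro PiM_cong) auto
  also have "\<dots> = distr (measure_pmf ?\<Pi>) (\<Pi>\<^sub>M i\<in>I. ?C) (\<lambda>f. restrict f I)"
    by (rule prob_space.indep_vars_iff_distr_eq_PiM'[OF prob_space_measure_pmf I(2), THEN iffD1,
          OF _ indep_vars_Pi_pmf[OF I(1)], symmetric]) simp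
  finally show ?thesis .
qed

lemma (in prob_space) prob_iid_entries:
  fixes X :: "'a \<Rightarrow> 'b::{countable, zero} mat"
  assumes dims: "nr > 0" "nc > 0"
    and X: "\<And>\<omega>. \<omega> \<in> space M \<Longrightarrow> X \<omega> \<in> carrier_mat nr nc"
    and indep: "indep_vars (\<lambda>_. count_space UNIV) (\<lambda>ij \<omega>. X \<omega> $$ ij) ({..<nr} \<times> {..<nc})"
    and law: "\<And>i j. i < nr \<Longrightarrow> j < nc
      \<Longrightarrow> distr M (count_space UNIV) (\<lambda>\<omega>. X \<omega> $$ (i, j)) = measure_pmf D"
  shows "prob {\<omega> \<in> space M. R (X \<omega>)} = measure_pmf.prob (iid_mat nr nc D) {A. R A}"
proof -
  let ?I = "{..<nr} \<times> {..<nc}"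
  let ?P = "\<Pi>\<^sub>M ij\<in>?I. count_space (UNIV :: 'b set)" and ?\<Pi> = "Pi_pmf ?I 0 (\<lambda>_. D)"
  let ?Y = "\<lambda>\<omega>. \<lambda>ij\<in>?I. X \<omega> $$ ij" and ?E = "{f \<in> space ?P. R (mat nr nc f)}"
  have I: "finite ?I" "?I \<noteq> {}" using dims by auto
  have distr_eq: "distr M ?P ?Y = distr (measure_pmf ?\<Pi>) ?P (\<lambda>f. restrict f ?I)"
    using law by (intro distr_restrict_eq_Pi_pmf[OF I indep]) auto
  have "?P = count_space (\<Pi>\<^sub>E ij\<in>?I. UNIV)"
    using I by (intro count_space_PiM_finite) simp_all
  hence E: "?E \<in> sets ?P" by simp
  have mat_Y: "mat nr nc (?Y \<omega>) = X \<omega>" if "\<omega> \<in> space M" for \<omega>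
    using X[OF that] by (intro eq_matI) auto
  have mat_restrict: "mat nr nc (restrict f ?I) = mat nr nc f" for f :: "_ \<Rightarrow> 'b" by (intro eq_matI) auto
  have "?Y \<in> measurable M ?P"
    using indep by (intro measurable_restrict) (auto simp: indep_vars_def)
  hence "prob {\<omega> \<in> space M. R (X \<omega>)} = measure (distr M ?P ?Y) ?E"
    using E mat_Y by (subst measure_distr) (auto simp: space_PiM intro!: arg_cong[where f = prob])
  also have "\<dots> = measure_pmf.prob ?\<Pi> {f. R (mat nr nc f)}"
    unfolding distr_eq using E mat_restrict
    by (subst measure_distr) (auto simp: space_PiM intro!: arg_cong[where f = "measure_pmf.prob ?\<Pi>"])
  also have "\<dots> = measure_pmf.prob (iid_mat nr nc D) {A. R A}"
    by (simp add: iid_mat_def vimage_def)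
  finally show ?thesis .
qed

subsection \<open>The law of the Krylov type\<close>

abbreviation residue_pmf :: "int \<Rightarrow> int pmf" where
  "residue_pmf q \<equiv> pmf_of_set {0..<q}"

lemma map_mod_residue_pmf:
  assumes r: "r > 0" and q: "q > 0"
  shows "map_pmf (\<lambda>a. a mod q) (residue_pmf (r * q)) = residue_pmf q"
proof -
  define block where "block b = {a. a div q = b}" for b
  have block: "block b = (\<lambda>a. b * q + a) ` {0..<q}" for b
  proof (intro equalityI subsetI)
    fix a assume "a \<in> block b"
    hence "a = b * q + a mod q" by (auto simp: block_def)
    thus "a \<in> (\<lambda>a. b * q + a) ` {0..<q}" using q by (intro image_eqI[of _ _ "a mod q"]) auto
  qed (auto simp: block_def simp del: image_add_atLeastLessThan)
  have "a div q < r \<longleftrightarrow> a < r * q" for a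
    using pos_imp_zdiv_neg_iff[OF q, of "a + (- r) * q"] div_mult_self1[of q a "- r"] q by simp
  hence "a div q \<in> {0..<r} \<longleftrightarrow> a \<in> {0..<r * q}" for a
    using q by (simp add: pos_imp_zdiv_nonneg_iff)
  hence "{0..<r * q} = (\<Union>b\<in>{0..<r}. block b)" unfolding block_def by blast
  moreover have "pmf_of_set (\<Union>b\<in>{0..<r}. block b) = residue_pmf r \<bind> (\<lambda>b. pmf_of_set (block b))"
  proof (rule pmf_of_set_UN)
    show "card (block b) = nat q" for b by (simp add: block)
    show "disjoint_family_on block {0..<r}" by (auto simp: disjoint_family_on_def block_def)
  qed (use r q in \<open>auto simp: block\<close>)
  moreover have "pmf_of_set (block b) = map_pmf (\<lambda>a. b * q + a) (residue_pmf q)" for b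
    unfolding block using q by (intro map_pmf_of_set_inj[symmetric]) auto
  moreover have "map_pmf (\<lambda>a. (b * q + a) mod q) (residue_pmf q) = residue_pmf q" for b
  proof -
    have "map_pmf (\<lambda>a. (b * q + a) mod q) (residue_pmf q) = map_pmf (\<lambda>a. a) (residue_pmf q)"
      using q by (intro map_pmf_cong) auto
    thus ?thesis by simp
  qed
  ultimately show ?thesis by (simp add: map_bind_pmf map_pmf_comp)
qed

lemma conj_iid_mat_residue_pmf:
  assumes q: "q > 0" and PQ: "inverse_mats n P Q"
  shows "map_pmf (\<lambda>A. (P * A * Q) mmod q) (iid_mat n n (residue_pmf q)) = iid_mat n n (residue_pmf q)"
proof -
  define S where "S = {A \<in> carrier_mat n n. \<forall>i<n. \<forall>j<n. A $$ (i, j) \<in> {0..<q}}"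
  have reduced: "B mmod q \<in> S" if "B \<in> carrier_mat n n" for B
    using that q by (auto simp: S_def)
  have closed: "(U * A * V) mmod q \<in> S" if UV: "inverse_mats n U V" and A: "A \<in> S" for U V A
    using inverse_matsD(1,2)[OF UV] A by (intro reduced) (auto simp: S_def)
  have inverse: "(U * ((V * A * U) mmod q) * V) mmod q = A"
    if UV: "inverse_mats n U V" and A: "A \<in> S" for U V A
  proof -
    note U = inverse_matsD(1)[OF UV] and V = inverse_matsD(2)[OF UV]
    have A_carrier: "A \<in> carrier_mat n n" and "A mmod q = A"
      using A by (auto simp: S_def intro!: eq_matI)
    moreover have "(U * ((V * A * U) mmod q) * V) mmod q = (U * (V * A * U) * V) mmod q"
      using U V A_carrier by (intro conj_mat_mmod) simp_all
    ultimately show ?thesis by (simp add: inverse_mats_conj[OF UV A_carrier])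
  qed
  note QP = inverse_mats_sym[OF PQ]
  have "bij_betw (\<lambda>A. (P * A * Q) mmod q) S S"
    using inverse[OF PQ] inverse[OF QP] closed[OF PQ] closed[OF QP]
    by (intro bij_betw_byWitness[where f' = "\<lambda>A. (Q * A * P) mmod q"]) auto
  moreover have "finite S" "S \<noteq> {}" "iid_mat n n (residue_pmf q) = pmf_of_set S"
    using q iid_mat_pmf_of_set[of "{0..<q}" n n] by (simp_all add: S_def)
  ultimately show ?thesis by (simp add: map_pmf_of_set_bij_betw)
qed

definition krylov_type_pmf :: "nat \<Rightarrow> nat \<Rightarrow> int vec \<Rightarrow> (nat \<Rightarrow> nat) pmf" where
  "krylov_type_pmf p m v = map_pmf (\<lambda>A. krylov_type p m A v)
    (iid_mat (dim_vec v) (dim_vec v) (residue_pmf (int p ^ m)))"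

definition uniform_type_pmf :: "nat \<Rightarrow> nat \<Rightarrow> nat \<Rightarrow> (nat \<Rightarrow> nat) pmf" where
  "uniform_type_pmf p m n = iid_vec n (residue_pmf (int p ^ m)) \<bind> krylov_type_pmf p m"

lemma uniform_type_pmf_eq_map_pair:
  "uniform_type_pmf p m n = map_pmf (\<lambda>(v, A). krylov_type p m A v)
    (pair_pmf (iid_vec n (residue_pmf (int p ^ m))) (iid_mat n n (residue_pmf (int p ^ m))))"
proof -
  have "uniform_type_pmf p m n = iid_vec n (residue_pmf (int p ^ m)) \<bind>
      (\<lambda>v. map_pmf (\<lambda>A. krylov_type p m A v) (iid_mat n n (residue_pmf (int p ^ m))))"
    unfolding uniform_type_pmf_def krylov_type_pmf_def
    using set_iid_vec[of n "residue_pmf (int p ^ m)"] by (intro bind_pmf_cong refl) auto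
  thus ?thesis by (simp add: pair_pmf_def map_bind_pmf map_pmf_def bind_assoc_pmf bind_return_pmf)
qed

lemma krylov_type_pmf_primitive:
  assumes p: "prime p" and v: "v \<in> carrier_vec (Suc n)" and s: "s < Suc n" "\<not> int p dvd v $ s"
  shows "krylov_type_pmf p m v = uniform_type_pmf p m n"
proof -
  let ?q = "int p ^ m"
  let ?U = "iid_mat (Suc n) (Suc n) (residue_pmf ?q)"
  have coprime: "coprime (v $ s) ?q" using p s(2) by (simp add: coprime_commute prime_imp_coprime)
  obtain P Q where PQ: "inverse_mats (Suc n) P Q"
    and Pv: "(P *\<^sub>v v) vmod ?q = ((v $ s) \<cdot>\<^sub>v unit_vec (Suc n) 0) vmod ?q"
    using exists_inverse_mats_to_unit_vec_mod[OF v s(1) coprime, of 0] by blast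
  let ?B = "\<lambda>A. (P * A * Q) mmod ?q"
  have "krylov_type_pmf p m v = map_pmf (\<lambda>A. krylov_type p m A v) ?U"
    using v by (simp add: krylov_type_pmf_def)
  also have "\<dots> = map_pmf (\<lambda>A. krylov_type p m (lower_block (?B A)) (lower_col (?B A))) ?U"
  proof (rule map_pmf_cong[OF refl])
    fix A assume "A \<in> set_pmf ?U"
    hence A: "A \<in> carrier_mat (Suc n) (Suc n)" using set_iid_mat by blast
    show "krylov_type p m A v = krylov_type p m (lower_block (?B A)) (lower_col (?B A))"
      by (rule krylov_type_deflate[OF p PQ A v Pv coprime mmod_mmod])
  qed
  also have "\<dots> = map_pmf (\<lambda>B. krylov_type p m (lower_block B) (lower_col B))
      (map_pmf ?B ?U)"
    by (simp add: map_pmf_comp)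
  also have "map_pmf ?B ?U = ?U"
    using p by (intro conj_iid_mat_residue_pmf PQ) (simp add: prime_gt_0_nat)
  also have "map_pmf (\<lambda>B. krylov_type p m (lower_block B) (lower_col B)) ?U
      = map_pmf (\<lambda>(v, A). krylov_type p m A v) (map_pmf (\<lambda>B. (lower_col B, lower_block B)) ?U)"
    by (simp add: map_pmf_comp)
  also have "\<dots> = uniform_type_pmf p m n" unfolding lower_iid_mat uniform_type_pmf_eq_map_pair ..
  finally show ?thesis .
qed

lemma krylov_type_pmf_smult:
  assumes p: "prime p" and v: "v \<in> carrier_vec n"
  shows "krylov_type_pmf p (Suc m) (int p \<cdot>\<^sub>v v) = map_pmf (case_nat n) (krylov_type_pmf p m v)"
proof -
  let ?q = "int p ^ m" and ?U = "iid_mat n n (residue_pmf (int p ^ Suc m))"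
  have "krylov_type_pmf p (Suc m) (int p \<cdot>\<^sub>v v) = map_pmf (\<lambda>A. krylov_type p (Suc m) A (int p \<cdot>\<^sub>v v)) ?U"
    using v by (simp add: krylov_type_pmf_def)
  also have "\<dots> = map_pmf (\<lambda>A. case_nat n (krylov_type p m (A mmod ?q) v)) ?U"
  proof (rule map_pmf_cong[OF refl])
    fix A assume "A \<in> set_pmf ?U"
    hence A: "A \<in> carrier_mat n n" using set_iid_mat by blast
    show "krylov_type p (Suc m) A (int p \<cdot>\<^sub>v v) = case_nat n (krylov_type p m (A mmod ?q) v)"
      by (simp add: krylov_type_smult[OF p A v] krylov_type_mmod[OF A v])
  qed
  also have "\<dots> = map_pmf (case_nat n) (map_pmf (\<lambda>A. krylov_type p m A v) (map_pmf (\<lambda>A. A mmod ?q) ?U))"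
    by (simp add: map_pmf_comp)
  also have "map_pmf (\<lambda>A. A mmod ?q) ?U
      = iid_mat n n (map_pmf (\<lambda>a. a mod ?q) (residue_pmf (int p ^ Suc m)))"
    unfolding mmod_def by (rule map_mat_iid_mat) simp
  also have "map_pmf (\<lambda>a. a mod ?q) (residue_pmf (int p ^ Suc m)) = residue_pmf ?q"
    unfolding power_Suc using p by (intro map_mod_residue_pmf) (simp_all add: prime_gt_0_nat)
  finally show ?thesis using v by (simp add: krylov_type_pmf_def)
qed

definition residue_vecs :: "nat \<Rightarrow> int \<Rightarrow> int vec set" where
  "residue_vecs n q = {v \<in> carrier_vec n. \<forall>i<n. v $ i \<in> {0..<q}}"

lemma residue_vecs:
  assumes "q > 0"
  shows finite_residue_vecs: "finite (residue_vecs n q)"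
    and card_residue_vecs: "card (residue_vecs n q) = nat q ^ n"
    and iid_vec_residue_pmf: "iid_vec n (residue_pmf q) = pmf_of_set (residue_vecs n q)"
  using assms iid_vec_pmf_of_set[of "{0..<q}" n] by (simp_all add: residue_vecs_def)

lemma divisible_residue_vecs:
  assumes r: "r > 0"
  shows "{v \<in> residue_vecs n (r * q). \<forall>i<n. r dvd v $ i} = (\<lambda>v. r \<cdot>\<^sub>v v) ` residue_vecs n q"
proof -
  have mem_iff: "r * a \<in> {0..<r * q} \<longleftrightarrow> a \<in> {0..<q}" for a
    using r by (simp add: zero_le_mult_iff)
  show ?thesis
  proof (intro equalityI subsetI)
    fix v assume v: "v \<in> {v \<in> residue_vecs n (r * q). \<forall>i<n. r dvd v $ i}"
    then obtain w where w: "w \<in> carrier_vec n" "v = r \<cdot>\<^sub>v w"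
      by (auto simp: residue_vecs_def intro: dvd_vec_imp_smult[of v n r])
    hence "w \<in> residue_vecs n q" using v mem_iff by (auto simp: residue_vecs_def)
    thus "v \<in> (\<lambda>v. r \<cdot>\<^sub>v v) ` residue_vecs n q" using w(2) by blast
  qed (use r in \<open>auto simp: residue_vecs_def\<close>)
qed

lemma pmf_map_case_nat:
  "pmf (map_pmf (case_nat k) M) c = (if c 0 = k then pmf M (\<lambda>i. c (Suc i)) else 0)"
proof (cases "c 0 = k")
  case True
  have "inj (case_nat k :: (nat \<Rightarrow> 'a) \<Rightarrow> _)" by (auto simp: inj_def fun_eq_iff split: nat.splits)
  moreover have "c = case_nat k (\<lambda>i. c (Suc i))" using True by (auto split: nat.split)
  ultimately show ?thesis using True by (metis pmf_map_inj')
next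
  case False
  hence "c \<notin> set_pmf (map_pmf (case_nat k) M)" by auto
  hence "pmf (map_pmf (case_nat k) M) c = 0" by (simp only: pmf_eq_0_set_pmf not_False_eq_True)
  thus ?thesis using False by simp
qed

lemma pmf_uniform_type_pmf:
  assumes "p > 0"
  shows "pmf (uniform_type_pmf p m n) c
    = (\<Sum>v\<in>residue_vecs n (int p ^ m). pmf (krylov_type_pmf p m v) c) / card (residue_vecs n (int p ^ m))"
proof -
  have q: "int p ^ m > 0" using assms by simp
  hence "card (residue_vecs n (int p ^ m)) > 0" by (simp add: card_residue_vecs)
  hence "residue_vecs n (int p ^ m) \<noteq> {}" by force
  thus ?thesis unfolding uniform_type_pmf_def iid_vec_residue_pmf[OF q]
    by (intro pmf_bind_pmf_of_set finite_residue_vecs[OF q])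
qed

lemma sum_pmf_krylov_type_divisible:
  assumes p: "prime p"
  shows "(\<Sum>v\<in>(\<lambda>v. int p \<cdot>\<^sub>v v) ` residue_vecs n (int p ^ m). pmf (krylov_type_pmf p (Suc m) v) c)
    = real (card (residue_vecs n (int p ^ m)))
      * (if c 0 = n then pmf (uniform_type_pmf p m n) (\<lambda>i. c (Suc i)) else 0)"
proof -
  let ?W = "residue_vecs n (int p ^ m)"
  have p0: "p > 0" using p by (rule prime_gt_0_nat)
  have inj: "inj_on (\<lambda>v. int p \<cdot>\<^sub>v v) ?W" using p0 by (auto simp: inj_on_def vec_eq_iff)
  have "(\<Sum>v\<in>(\<lambda>v. int p \<cdot>\<^sub>v v) ` ?W. pmf (krylov_type_pmf p (Suc m) v) c)
      = (\<Sum>v\<in>?W. pmf (krylov_type_pmf p (Suc m) (int p \<cdot>\<^sub>v v)) c)"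
    by (simp add: sum.reindex[OF inj])
  also have "\<dots> = (\<Sum>v\<in>?W. if c 0 = n then pmf (krylov_type_pmf p m v) (\<lambda>i. c (Suc i)) else 0)"
    by (intro sum.cong) (auto simp: residue_vecs_def krylov_type_pmf_smult[OF p] pmf_map_case_nat)
  also have "\<dots> = real (card ?W) * (if c 0 = n then pmf (uniform_type_pmf p m n) (\<lambda>i. c (Suc i)) else 0)"
    using p0 by (simp add: pmf_uniform_type_pmf[OF p0] card_residue_vecs)
  finally show ?thesis .
qed

lemma sum_pmf_krylov_type_primitive:
  fixes m n :: nat
  assumes p: "prime p"
  defines "V \<equiv> residue_vecs (Suc n) (int p ^ Suc m)" and "W \<equiv> residue_vecs (Suc n) (int p ^ m)"
  shows "(\<Sum>v\<in>V - (\<lambda>v. int p \<cdot>\<^sub>v v) ` W. pmf (krylov_type_pmf p (Suc m) v) c)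
    = (real (card V) - real (card W)) * pmf (uniform_type_pmf p (Suc m) n) c"
proof -
  let ?N = "(\<lambda>v. int p \<cdot>\<^sub>v v) ` W"
  have p0: "p > 0" using p by (rule prime_gt_0_nat)
  have N: "?N = {v \<in> V. \<forall>i<Suc n. int p dvd v $ i}"
    unfolding V_def W_def power_Suc using p0 by (intro divisible_residue_vecs[symmetric]) simp
  have finite: "finite V" and N_subset: "?N \<subseteq> V"
    using p0 N by (auto simp: V_def finite_residue_vecs)
  have card_N: "card ?N = card W"
    using p0 by (intro card_image) (auto simp: inj_on_def vec_eq_iff)
  hence "card W \<le> card V" using card_mono[OF finite N_subset] by simp
  moreover have "card (V - ?N) = card V - card W"
    unfolding card_N[symmetric] using finite_subset[OF N_subset finite] N_subset by (rule card_Diff_subset)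
  ultimately have card_diff: "real (card (V - ?N)) = real (card V) - real (card W)"
    by (simp only: of_nat_diff)
  have "pmf (krylov_type_pmf p (Suc m) v) c = pmf (uniform_type_pmf p (Suc m) n) c" if "v \<in> V - ?N" for v
  proof -
    obtain s where s: "v \<in> carrier_vec (Suc n)" "s < Suc n" "\<not> int p dvd v $ s"
      using \<open>v \<in> V - ?N\<close> unfolding N by (auto simp: V_def residue_vecs_def)
    show ?thesis unfolding krylov_type_pmf_primitive[OF p s] ..
  qed
  thus ?thesis by (simp add: card_diff)
qed

lemma pmf_uniform_type_pmf_Suc:
  assumes p: "prime p"
  shows "pmf (uniform_type_pmf p (Suc m) (Suc n)) c
    = (1 - 1 / real p ^ Suc n) * pmf (uniform_type_pmf p (Suc m) n) c
      + 1 / real p ^ Suc n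
        * (if c 0 = Suc n then pmf (uniform_type_pmf p m (Suc n)) (\<lambda>i. c (Suc i)) else 0)"
proof -
  let ?V = "residue_vecs (Suc n) (int p ^ Suc m)" and ?W = "residue_vecs (Suc n) (int p ^ m)"
  let ?N = "(\<lambda>v. int p \<cdot>\<^sub>v v) ` ?W" and ?f = "\<lambda>v. pmf (krylov_type_pmf p (Suc m) v) c"
  have p0: "p > 0" using p by (rule prime_gt_0_nat)
  have card_W: "real (card ?W) > 0" and card_V: "real (card ?V) = real p ^ Suc n * real (card ?W)"
    using p0 by (simp_all add: card_residue_vecs nat_mult_distrib nat_power_eq power_mult_distrib)
  have "?N = {v \<in> ?V. \<forall>i<Suc n. int p dvd v $ i}"
    unfolding power_Suc using p0 by (intro divisible_residue_vecs[symmetric]) simp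
  hence "?N \<subseteq> ?V" by blast
  hence "sum ?f ?V = sum ?f (?V - ?N) + sum ?f ?N"
    using p0 by (intro sum.subset_diff finite_residue_vecs) simp_all
  hence "pmf (uniform_type_pmf p (Suc m) (Suc n)) c
      = ((real (card ?V) - real (card ?W)) * pmf (uniform_type_pmf p (Suc m) n) c
        + real (card ?W) * (if c 0 = Suc n then pmf (uniform_type_pmf p m (Suc n)) (\<lambda>i. c (Suc i)) else 0))
        / real (card ?V)"
    by (simp only: pmf_uniform_type_pmf[OF p0, of "Suc m"] sum_pmf_krylov_type_primitive[OF p]
        sum_pmf_krylov_type_divisible[OF p])
  moreover have "((a * w - w) * x + w * y) / (a * w) = (1 - 1 / a) * x + 1 / a * y"
    if "a > 0" "w > 0" for a w x y :: real
    using that by (simp add: field_simps)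
  ultimately show ?thesis unfolding card_V using p0 card_W by (simp only: of_nat_0_less_iff zero_less_power)
qed

subsection \<open>The limit\<close>

lemma set_uniform_type_pmfE:
  assumes "c \<in> set_pmf (uniform_type_pmf p m n)"
  obtains v A where "v \<in> carrier_vec n" "A \<in> carrier_mat n n" "c = krylov_type p m A v"
proof -
  obtain v A where "v \<in> set_pmf (iid_vec n (residue_pmf (int p ^ m)))"
    and "A \<in> set_pmf (iid_mat n n (residue_pmf (int p ^ m)))" and "c = krylov_type p m A v"
    using assms by (auto simp: uniform_type_pmf_eq_map_pair)
  thus thesis using that set_iid_vec set_iid_mat by blast
qed

lemma set_uniform_type_pmf_le: "c \<in> set_pmf (uniform_type_pmf p m n) \<Longrightarrow> c k \<le> n"
  by (elim set_uniform_type_pmfE) (metis krylov_type_le_dim carrier_vecD)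

lemma pmf_uniform_type_pmf_eq_0: "n < c k \<Longrightarrow> pmf (uniform_type_pmf p m n) c = 0"
  using set_uniform_type_pmf_le[of c p m n k] by (force simp: set_pmf_iff)

lemma uniform_type_pmf_modulus_1:
  assumes "p \<ge> 2"
  shows "uniform_type_pmf p 0 n = return_pmf (\<lambda>k. 0)"
proof -
  have "set_pmf (uniform_type_pmf p 0 n) \<subseteq> {\<lambda>k. 0}"
    by (auto elim!: set_uniform_type_pmfE simp: krylov_type_0[OF assms])
  thus ?thesis by (simp add: set_pmf_subset_singleton)
qed

lemma uniform_type_pmf_dim_0: "uniform_type_pmf p m 0 = return_pmf (\<lambda>k. 0)"
proof -
  have "set_pmf (uniform_type_pmf p m 0) \<subseteq> {\<lambda>k. 0}" using set_uniform_type_pmf_le[of _ p m 0] by auto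
  thus ?thesis by (simp add: set_pmf_subset_singleton)
qed

text \<open>At \<open>n = c 0\<close> the starting vector must vanish modulo \<open>p\<close>, since \<open>c\<close> does not occur in smaller
  dimensions.\<close>

lemma pmf_uniform_type_pmf_dim_eq:
  assumes p: "prime p" and n: "c 0 = n"
  shows "pmf (uniform_type_pmf p (Suc m) n) c
    = 1 / real p ^ n * pmf (uniform_type_pmf p m n) (\<lambda>k. c (Suc k))"
proof (cases n)
  case 0
  have "c = (\<lambda>k. 0) \<longleftrightarrow> (\<lambda>k. c (Suc k)) = (\<lambda>k. 0)"
    using n 0 by (metis not0_implies_Suc)
  thus ?thesis using 0 by (auto simp: uniform_type_pmf_dim_0 indicator_def)
next
  case (Suc r)
  thus ?thesis using n by (simp add: pmf_uniform_type_pmf_Suc[OF p] pmf_uniform_type_pmf_eq_0[of r c 0])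
qed

lemma pmf_uniform_type_pmf_dim_ge:
  assumes p: "prime p" and "c 0 \<le> n"
  shows "pmf (uniform_type_pmf p (Suc m) n) c
    = (\<Prod>i\<in>{c 0<..n}. 1 - 1 / real p ^ i) * pmf (uniform_type_pmf p (Suc m) (c 0)) c"
  using assms(2)
proof (induction n rule: dec_induct)
  case (step n)
  have "{c 0<..Suc n} = insert (Suc n) {c 0<..n}" using step.hyps by auto
  thus ?case using step by (simp add: pmf_uniform_type_pmf_Suc[OF p])
qed simp

lemma pmf_uniform_type_pmf_closed_form:
  assumes p: "prime p" and "\<And>k. c (Suc k) \<le> c k" and "\<And>k. m < k \<Longrightarrow> c k = 0" and "c 0 \<le> n"
  shows "pmf (uniform_type_pmf p (Suc m) n) c
    = (\<Prod>k\<le>m. 1 / real p ^ c k) * (\<Prod>i\<in>{c m<..n}. 1 - 1 / real p ^ i)"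
  using assms(2-)
proof (induction m arbitrary: c n)
  case 0
  have "(\<lambda>k. c (Suc k)) = (\<lambda>k. 0)" using 0(2) by auto
  thus ?case using prime_ge_2_nat[OF p]
    by (simp add: pmf_uniform_type_pmf_dim_ge[where c = c, OF p 0(3)]
        pmf_uniform_type_pmf_dim_eq[where c = c, OF p refl] uniform_type_pmf_modulus_1)
next
  case (Suc m)
  have anti: "c (Suc k) \<le> c 0" for k by (induction k) (use Suc.prems(1) order_trans in blast)+
  have "pmf (uniform_type_pmf p (Suc m) (c 0)) (\<lambda>k. c (Suc k))
      = (\<Prod>k\<le>m. 1 / real p ^ c (Suc k)) * (\<Prod>i\<in>{c (Suc m)<..c 0}. 1 - 1 / real p ^ i)"
    using Suc.prems(1,2) by (intro Suc.IH) auto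
  hence "pmf (uniform_type_pmf p (Suc (Suc m)) n) c
      = (\<Prod>i\<in>{c 0<..n}. 1 - 1 / real p ^ i) * (1 / real p ^ c 0 * ((\<Prod>k\<le>m. 1 / real p ^ c (Suc k))
        * (\<Prod>i\<in>{c (Suc m)<..c 0}. 1 - 1 / real p ^ i)))"
    by (simp add: pmf_uniform_type_pmf_dim_ge[where c = c, OF p Suc.prems(3)]
        pmf_uniform_type_pmf_dim_eq[where c = c, OF p refl])
  also have "\<dots> = (1 / real p ^ c 0 * (\<Prod>k\<le>m. 1 / real p ^ c (Suc k)))
      * ((\<Prod>i\<in>{c (Suc m)<..c 0}. 1 - 1 / real p ^ i) * (\<Prod>i\<in>{c 0<..n}. 1 - 1 / real p ^ i))"
    by (simp only: mult_ac)
  also have "(\<Prod>i\<in>{c (Suc m)<..c 0}. 1 - 1 / real p ^ i) * (\<Prod>i\<in>{c 0<..n}. 1 - 1 / real p ^ i)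
      = (\<Prod>i\<in>{c (Suc m)<..n}. 1 - 1 / real p ^ i)"
    using anti[of m] Suc.prems(3) by (subst prod.union_disjoint[symmetric]) (auto simp: ivl_disj_un)
  also have "1 / real p ^ c 0 * (\<Prod>k\<le>m. 1 / real p ^ c (Suc k)) = (\<Prod>k\<le>Suc m. 1 / real p ^ c k)"
    by (rule prod.atMost_Suc_shift[symmetric])
  finally show ?case .
qed

lemma (in prob_space) prob_coker_walk_matrix:
  assumes p: "prime p" and J: "finite J"
    and X: "\<And>\<omega>. \<omega> \<in> space M \<Longrightarrow> X \<omega> \<in> carrier_mat (Suc n) (Suc n)"
    and indep: "indep_vars (\<lambda>_. count_space UNIV) (\<lambda>ij \<omega>. X \<omega> $$ ij) ({..<Suc n} \<times> {..<Suc n})"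
    and law: "\<And>i j. i < Suc n \<Longrightarrow> j < Suc n
      \<Longrightarrow> distr M (count_space UNIV) (\<lambda>\<omega>. X \<omega> $$ (i, j)) = measure_pmf (residue_pmf (int p ^ m))"
    and b: "b \<in> carrier_vec (Suc n)" and s: "s < Suc n" "\<not> int p dvd b $ s"
  shows "prob {\<omega> \<in> space M. quot_multiples (coker (walk_matrix (X \<omega>) b)) (p ^ m) \<cong> cyclic_sum p J \<nu>}
    = pmf (uniform_type_pmf p m n) (conjugate_partition J \<nu>)"
proof -
  have "prob {\<omega> \<in> space M. quot_multiples (coker (walk_matrix (X \<omega>) b)) (p ^ m) \<cong> cyclic_sum p J \<nu>}
      = prob {\<omega> \<in> space M. krylov_type p m (X \<omega>) b = conjugate_partition J \<nu>}"
    by (intro arg_cong[where f = prob] Collect_cong conj_cong refl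
        coker_walk_matrix_iso_iff_krylov_type[OF p X b J])
  also have "\<dots> = measure_pmf.prob (iid_mat (Suc n) (Suc n) (residue_pmf (int p ^ m)))
      {A. krylov_type p m A b = conjugate_partition J \<nu>}"
    by (rule prob_iid_entries[OF zero_less_Suc zero_less_Suc X indep law])
  also have "\<dots> = pmf (krylov_type_pmf p m b) (conjugate_partition J \<nu>)"
    using b by (simp add: krylov_type_pmf_def pmf_map vimage_def)
  also have "\<dots> = pmf (uniform_type_pmf p m n) (conjugate_partition J \<nu>)"
    unfolding krylov_type_pmf_primitive[OF p b s] ..
  finally show ?thesis .
qed

lemma tendsto_prod_one_minus_inverse_power:
  fixes x :: real
  assumes "x > 1"
  shows "(\<lambda>n. \<Prod>i\<in>{k<..n}. 1 - 1 / x ^ i) \<longlonglongrightarrow> (\<Prod>i. 1 - 1 / x ^ (k + i + 1))"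
proof (rule LIMSEQ_offset[where k = "k + 1"])
  have "summable (\<lambda>i. (1 / x) ^ i)" using assms by (intro summable_geometric) simp
  hence "summable (\<lambda>i. (1 / x) ^ (k + 1) * (1 / x) ^ i)" by (rule summable_mult)
  hence "summable (\<lambda>i. norm ((1 - 1 / x ^ (k + i + 1)) - 1))"
    using assms by (simp add: power_add power_one_over field_simps)
  hence "convergent_prod (\<lambda>i. 1 - 1 / x ^ (k + i + 1))"
    by (intro abs_convergent_prod_imp_convergent_prod summable_imp_abs_convergent_prod)
  moreover have "(\<Prod>i\<in>{k<..n + (k + 1)}. 1 - 1 / x ^ i) = (\<Prod>i\<le>n. 1 - 1 / x ^ (k + i + 1))" for n
    by (rule prod.reindex_bij_witness[of _ "\<lambda>i. k + i + 1" "\<lambda>i. i - k - 1"]) auto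
  ultimately show "(\<lambda>n. \<Prod>i\<in>{k<..n + (k + 1)}. 1 - 1 / x ^ i) \<longlonglongrightarrow> (\<Prod>i. 1 - 1 / x ^ (k + i + 1))"
    using convergent_prod_LIMSEQ by simp
qed

lemma tendsto_pmf_uniform_type_pmf:
  assumes p: "prime p" and c: "\<And>k. c (Suc k) \<le> c k" "\<And>k. m < k \<Longrightarrow> c k = 0"
  shows "(\<lambda>n. pmf (uniform_type_pmf p (Suc m) n) c)
    \<longlonglongrightarrow> (\<Prod>i. 1 - 1 / real p ^ (c m + i + 1)) * (\<Prod>k\<le>m. 1 / real p ^ c k)"
proof (rule Lim_transform_eventually)
  show "(\<lambda>n. (\<Prod>i\<in>{c m<..n}. 1 - 1 / real p ^ i) * (\<Prod>k\<le>m. 1 / real p ^ c k))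
      \<longlonglongrightarrow> (\<Prod>i. 1 - 1 / real p ^ (c m + i + 1)) * (\<Prod>k\<le>m. 1 / real p ^ c k)"
    using prime_gt_1_nat[OF p] by (intro tendsto_mult_right tendsto_prod_one_minus_inverse_power) simp
  show "\<forall>\<^sub>F n in sequentially. (\<Prod>i\<in>{c m<..n}. 1 - 1 / real p ^ i) * (\<Prod>k\<le>m. 1 / real p ^ c k)
      = pmf (uniform_type_pmf p (Suc m) n) c"
    using eventually_ge_at_top[of "c 0"]
    by eventually_elim
      (simp add: pmf_uniform_type_pmf_closed_form[where c = c and m = m, OF p c] mult.commute)
qed

lemma sum_weighted_differences:
  fixes f :: "nat \<Rightarrow> nat"
  assumes "f 0 = 0" and "\<And>i. i < l \<Longrightarrow> f i \<le> f (Suc i)"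
  shows "(\<Sum>j=1..l. j * (f (l - j + 1) - f (l - j))) = (\<Sum>i=1..l. f i)"
proof -
  have telescope: "(\<Sum>i<k. f (Suc i) - f i) = f k" if "k \<le> l" for k
    using that by (induction k) (simp_all add: assms Suc_le_eq)
  have "(\<Sum>i<k. (k - i) * (f (Suc i) - f i)) = (\<Sum>i=1..k. f i)" if "k \<le> l" for k
    using that
  proof (induction k)
    case (Suc k)
    have "(\<Sum>i<Suc k. (Suc k - i) * (f (Suc i) - f i))
        = (\<Sum>i<Suc k. (k - i) * (f (Suc i) - f i) + (f (Suc i) - f i))"
      by (intro sum.cong) (auto simp: Suc_diff_le)
    thus ?case using Suc unfolding sum.distrib telescope[OF Suc.prems] by simp
  qed simp
  moreover have "(\<Sum>j=1..l. j * (f (l - j + 1) - f (l - j))) = (\<Sum>i<l. (l - i) * (f (Suc i) - f i))"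
    by (rule sum.reindex_bij_witness[of _ "\<lambda>i. l - i" "\<lambda>j. l - j"]) auto
  ultimately show ?thesis by simp
qed

lemma tendsto_pmf_uniform_type_pmf_conjugate_partition:
  assumes p: "prime p" and "m \<ge> 1" and J: "finite J" and \<nu>: "\<And>j. j \<in> J \<Longrightarrow> \<nu> j \<le> m"
  shows "(\<lambda>n. pmf (uniform_type_pmf p m n) (conjugate_partition J \<nu>))
    \<longlonglongrightarrow> (\<Prod>i. 1 - 1 / real p ^ (card {j \<in> J. \<nu> j = m} + i + 1)) * (1 / real p ^ (\<Sum>j\<in>J. \<nu> j))"
proof -
  obtain r where m: "m = Suc r" using assms(2) by (cases m) auto
  have "{j \<in> J. r < \<nu> j} = {j \<in> J. \<nu> j = m}" using \<nu> by (force simp: m)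
  hence last: "conjugate_partition J \<nu> r = card {j \<in> J. \<nu> j = m}" by (simp add: conjugate_partition_def)
  have "(\<Prod>k\<le>r. 1 / real p ^ conjugate_partition J \<nu> k) = 1 / real p ^ (\<Sum>k<m. conjugate_partition J \<nu> k)"
    by (simp add: m prod_dividef lessThan_Suc_atMost power_sum)
  also have "(\<Sum>k<m. conjugate_partition J \<nu> k) = (\<Sum>j\<in>J. \<nu> j)" by (rule sum_conjugate_partition[OF J \<nu>])
  finally have weight: "(\<Prod>k\<le>r. 1 / real p ^ conjugate_partition J \<nu> k) = 1 / real p ^ (\<Sum>j\<in>J. \<nu> j)" .
  have vanish: "conjugate_partition J \<nu> k = 0" if "r < k" for k
    using \<nu> that by (fastforce simp: m intro: conjugate_partition_eq_0)
  from tendsto_pmf_uniform_type_pmf[where c = "conjugate_partition J \<nu>" and m = r,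
      OF p conjugate_partition_Suc_le[OF J] vanish]
  show ?thesis unfolding m[symmetric] last weight .
qed

theorem theorem1p2:
  fixes p m l :: nat
    and lam \<delta> :: "nat \<Rightarrow> nat"
    and i0 :: nat
    and M :: "nat \<Rightarrow> 'a measure"
    and X :: "nat \<Rightarrow> 'a \<Rightarrow> int mat"
    and b :: "nat \<Rightarrow> int vec"
  assumes "prime p" and "m \<ge> 1"
    and "\<And>n. n \<ge> 1 \<Longrightarrow> prob_space (M n)"
    and "\<And>n \<omega>. n \<ge> 1 \<Longrightarrow> \<omega> \<in> space (M n) \<Longrightarrow> X n \<omega> \<in> carrier_mat n n"
    and "\<And>n. n \<ge> 1 \<Longrightarrow>
      prob_space.indep_vars (M n) (\<lambda>_. count_space UNIV) (\<lambda>ij \<omega>. X n \<omega> $$ ij) ({..<n} \<times> {..<n})"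
    and "\<And>n i j. n \<ge> 1 \<Longrightarrow> i < n \<Longrightarrow> j < n \<Longrightarrow>
      distr (M n) (count_space UNIV) (\<lambda>\<omega>. X n \<omega> $$ (i, j))
        = measure_pmf (pmf_of_set {0..int p ^ m - 1})"
    and "\<And>n. n \<ge> 1 \<Longrightarrow> b n \<in> carrier_vec n"
    and "\<And>n. n \<ge> 1 \<Longrightarrow> \<exists>i<n. \<not> [b n $ i = 0] (mod int p)"
    and "l \<ge> 1" and "lam 0 = 0" and "\<And>i. i < l \<Longrightarrow> lam i \<le> lam (Suc i)" and "lam l \<le> m"
    and "i0 = card {i. i \<le> l \<and> lam i = m}"
    and "\<And>j. 1 \<le> j \<Longrightarrow> j \<le> l \<Longrightarrow> \<delta> j = lam (l - j + 1) - lam (l - j)"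
  shows "(\<lambda>n. measure (M n)
            {\<omega> \<in> space (M n).
              quot_multiples (coker (walk_matrix (X n \<omega>) (b n))) (p ^ m)
                \<cong> sum_group {1..l} (\<lambda>i. integer_mod_group (p ^ lam i))})
         \<longlonglongrightarrow> (\<Prod>i. 1 - 1 / real p ^ (i0 + i + 1)) * (\<Prod>j=1..l. 1 / real p ^ (j * \<delta> j))"
proof (rule LIMSEQ_imp_Suc)
  have prob: "measure (M (Suc n)) {\<omega> \<in> space (M (Suc n)).
      quot_multiples (coker (walk_matrix (X (Suc n) \<omega>) (b (Suc n)))) (p ^ m) \<cong> cyclic_sum p {1..l} lam}
    = pmf (uniform_type_pmf p m n) (conjugate_partition {1..l} lam)" for n
  proof -
    interpret prob_space "M (Suc n)" by (rule assms(3)) simp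
    obtain s where "s < Suc n" "\<not> int p dvd b (Suc n) $ s"
      using assms(8)[of "Suc n"] by (auto simp: cong_0_iff)
    moreover have "{0..int p ^ m - 1} = {0..<int p ^ m}" by auto
    ultimately show ?thesis
      using assms(1,4-7) by (intro prob_coker_walk_matrix[where s = s]) auto
  qed
  have le_m: "lam i \<le> m" if "i \<le> l" for i
    using that by (induction rule: inc_induct) (use assms(11,12) order_trans in blast)+
  have "{i. i \<le> l \<and> lam i = m} = {i \<in> {1..l}. lam i = m}"
    using assms(2,10) by (auto simp: Suc_le_eq intro: gr0I)
  hence i0: "card {i \<in> {1..l}. lam i = m} = i0" using assms(13) by simp
  have "(\<Sum>i=1..l. lam i) = (\<Sum>j=1..l. j * \<delta> j)"
    using sum_weighted_differences[of lam l, OF assms(10,11)] assms(14) by simp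
  hence weight: "1 / real p ^ (\<Sum>i=1..l. lam i) = (\<Prod>j=1..l. 1 / real p ^ (j * \<delta> j))"
    by (simp add: power_sum prod_dividef)
  show "(\<lambda>n. measure (M (Suc n)) {\<omega> \<in> space (M (Suc n)).
      quot_multiples (coker (walk_matrix (X (Suc n) \<omega>) (b (Suc n)))) (p ^ m) \<cong> cyclic_sum p {1..l} lam})
    \<longlonglongrightarrow> (\<Prod>i. 1 - 1 / real p ^ (i0 + i + 1)) * (\<Prod>j=1..l. 1 / real p ^ (j * \<delta> j))"
    using le_m
      tendsto_pmf_uniform_type_pmf_conjugate_partition[OF assms(1,2) finite_atLeastAtMost, of 1 l lam]
    unfolding prob i0 weight by simp
qed

end
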